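(* Let $G$ be an abelian group. Let $n\geq s_2\geq s_1$ be integers with $s_1=\Omega(s_2)$, and let $m$ be an integer satisfying $s_1+s_2\leq m = o\big(s_2^2(\log s_2)^{-4}(\log n)^{-3}\big)$. Then for any $F_1,F_2\subset G$ with $|F_1|=|F_2|=n$, the number of pairs of sets $(X_1,X_2)$ with $X_1\subset F_1$, $X_2\subset F_2$, $|X_i|=s_i$ and $|X_1+X_2|\leq m$ is at most \[2^{o(s_2)}\binom{\frac{s_1}{s_1+s_2}(m+\beta)}{s_1}\binom{\frac{s_2}{s_1+s_2}(m+\beta)}{s_2},\] where $\beta = \beta((1+o(1))m)$.
   Context: For an abelian group $G$ and a positive real $t$, $\beta(t) = \max\{|H| : H \text{ a subgroup of } G,\ |H|\leq t\}$. $X_1+X_2=\{x_1+x_2:x_i\in X_i\}$. Binomial coefficients with non-integer upper argument are the generalized ones, $\binom{x}{k}=x(x-1)\cdots(x-k+1)/k!$. Asymptotic notation refers to $n\to\infty$ with $s_1,s_2,m$ depending on $n$. *)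

theory Defs
  imports "HOL-Algebra.Coset" "HOL-Library.Landau_Symbols"
begin

text \<open>
  Abelian groups are written multiplicatively as in HOL-Algebra, so the sumset of
  \<open>X\<^sub>1\<close> and \<open>X\<^sub>2\<close> is \<open>X\<^sub>1 <#>\<^bsub>G\<^esub> X\<^sub>2\<close>.

  The finiteness condition in \<open>subgroup_beta\<close> excludes infinite subgroups, whose \<open>card\<close> is 0.
  For \<open>t \<ge> 1\<close> the trivial subgroup makes the set of orders nonempty; for \<open>t < 1\<close> it is empty and
  the maximum is unspecified.
\<close>

definition subgroup_beta :: "('a, 'b) monoid_scheme \<Rightarrow> real \<Rightarrow> nat" where
  "subgroup_beta G t = Max {card H | H. subgroup H G \<and> finite H \<and> real (card H) \<le> t}"

definition small_sumset_pairs ::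
    "('a, 'b) monoid_scheme \<Rightarrow> 'a set \<Rightarrow> 'a set \<Rightarrow> nat \<Rightarrow> nat \<Rightarrow> nat \<Rightarrow> ('a set \<times> 'a set) set" where
  "small_sumset_pairs G F1 F2 s1 s2 m =
     {(X1, X2). X1 \<subseteq> F1 \<and> X2 \<subseteq> F2 \<and> card X1 = s1 \<and> card X2 = s2 \<and>
                card (X1 <#>\<^bsub>G\<^esub> X2) \<le> m}"

end

theory Submission imports Defs begin

text \<open>
  Containers. Fix a pair \<open>(X\<^sub>1, X\<^sub>2)\<close> with \<open>|X\<^sub>1X\<^sub>2| \<le> m\<close> and keep track of sets \<open>A\<^sub>i \<supseteq> X\<^sub>i\<close> and
  \<open>A \<subseteq> X\<^sub>1X\<^sub>2\<close>, starting with \<open>(F\<^sub>1, F\<^sub>2, {})\<close>. If more than \<open>\<epsilon>|A\<^sub>1||A\<^sub>2|\<close> pairs have their product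
  outside \<open>A\<close>, then revealing at most \<open>b\<close> elements of each \<open>X\<^sub>i\<close>, where \<open>b\<^sup>2\<close> is about \<open>\<epsilon>m / log n\<close>,
  either shrinks some \<open>A\<^sub>i\<close> by a constant factor or adds about \<open>\<epsilon>b\<^sup>2\<close> elements to \<open>A\<close>. Hence
  \<open>O(log n)\<close> rounds suffice, and all pairs are covered by \<open>exp (O(m\<^sup>1\<^sup>/\<^sup>2 (log n)\<^sup>3\<^sup>/\<^sup>2)) = 2\<^bsup>o(s\<^sub>2)\<^esup>\<close>
  terminal states, in which either \<open>|A\<^sub>1| + |A\<^sub>2| \<le> m\<close> or almost all products lie in \<open>A\<close>.

  Robust Kneser theorem. If almost all products of \<open>U\<close> and \<open>V\<close> lie in \<open>A\<close>, then
  \<open>|U| + |V| \<le> (1 + o(1))(|A| + |H|)\<close> for a subgroup \<open>H\<close> with \<open>|H| \<le> (1 + o(1))|A|\<close>. Dyson transforms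
  do not increase the truncated sum of the representation function \<open>r\<^bsub>U,V\<^esub>\<close> and preserve \<open>|U| + |V|\<close>.
  They are applied as long as \<open>V\<close> does not become too small. When no transform is left, either
  \<open>(U, V)\<close> has small multiplicative energy, or the popular quotients of \<open>V\<close> lie in the finite
  stabilizer \<open>H\<close> of \<open>{e. eV \<subseteq> U}\<close>; up to a set of small energy, \<open>V\<close> is then a part of one coset of \<open>H\<close>.

  A terminal state contains at most \<open>(|A\<^sub>1| + |A\<^sub>2|) choose (s\<^sub>1 + s\<^sub>2)\<close> pairs by Vandermonde, and the entropy
  estimate of this binomial coefficient splits in the proportion \<open>s\<^sub>1 : s\<^sub>2\<close>.
\<close>

section \<open>Truncated representation sums and the robust Kneser theorem\<close>

definition rep_count :: "('a, 'b) monoid_scheme \<Rightarrow> 'a set \<Rightarrow> 'a set \<Rightarrow> 'a \<Rightarrow> nat" where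
  "rep_count G U V x = card {p \<in> U \<times> V. fst p \<otimes>\<^bsub>G\<^esub> snd p = x}"

text \<open>The quantity in Pollard's theorem. A few exceptional pairs may inflate the product set
  considerably, but they change this sum by at most their number.\<close>

definition trunc_sum :: "('a, 'b) monoid_scheme \<Rightarrow> real \<Rightarrow> 'a set \<Rightarrow> 'a set \<Rightarrow> real" where
  "trunc_sum G t U V = (\<Sum>x\<in>U <#>\<^bsub>G\<^esub> V. min t (real (rep_count G U V x)))"

text \<open>The number of quadruples \<open>(u, v, u', v')\<close> with equal products
  \<open>u v = u' v'\<close>, grouped by the common product.\<close>

definition energy :: "('a, 'b) monoid_scheme \<Rightarrow> 'a set \<Rightarrow> 'a set \<Rightarrow> nat" where
  "energy G U V = (\<Sum>x\<in>U <#>\<^bsub>G\<^esub> V. (rep_count G U V x)\<^sup>2)"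

lemma set_mult_eq_image:
  "U <#>\<^bsub>G\<^esub> V = (\<lambda>p. fst p \<otimes>\<^bsub>G\<^esub> snd p) ` (U \<times> V)"
  unfolding set_mult_def image_def by auto

lemma finite_set_mult:
  "finite U \<Longrightarrow> finite V \<Longrightarrow> finite (U <#>\<^bsub>G\<^esub> V)"
  by (simp add: set_mult_eq_image)

lemma card_set_mult_le:
  assumes "finite U" "finite V"
  shows "card (U <#>\<^bsub>G\<^esub> V) \<le> card U * card V"
  unfolding set_mult_eq_image
  using card_image_le[of "U \<times> V"] assms by (simp add: card_cartesian_product)

lemma rep_count_eq_0_iff:
  assumes "finite U" "finite V"
  shows "rep_count G U V x = 0 \<longleftrightarrow> x \<notin> U <#>\<^bsub>G\<^esub> V"
proof -
  have "finite {p \<in> U \<times> V. fst p \<otimes>\<^bsub>G\<^esub> snd p = x}" using assms by auto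
  then show ?thesis by (force simp: rep_count_def set_mult_eq_image)
qed

lemma sum_rep_count_filter:
  assumes "finite U" "finite V"
  shows "(\<Sum>x\<in>{x \<in> U <#>\<^bsub>G\<^esub> V. P x}. rep_count G U V x)
       = card {p \<in> U \<times> V. P (fst p \<otimes>\<^bsub>G\<^esub> snd p)}"
proof -
  let ?S = "{p \<in> U \<times> V. P (fst p \<otimes>\<^bsub>G\<^esub> snd p)}"
  let ?T = "{x \<in> U <#>\<^bsub>G\<^esub> V. P x}"
  have "(\<Sum>y\<in>?T. \<Sum>x\<in>{x \<in> ?S. fst x \<otimes>\<^bsub>G\<^esub> snd x = y}. 1::nat) = (\<Sum>x\<in>?S. 1)"
    by (rule sum.group) (use assms in \<open>auto simp: finite_set_mult set_mult_eq_image\<close>)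
  moreover have "{x \<in> ?S. fst x \<otimes>\<^bsub>G\<^esub> snd x = y} = {p \<in> U \<times> V. fst p \<otimes>\<^bsub>G\<^esub> snd p = y}"
    if "y \<in> ?T" for y using that by auto
  ultimately show ?thesis by (simp add: rep_count_def)
qed

lemma sum_rep_count:
  assumes "finite U" "finite V"
  shows "(\<Sum>x\<in>U <#>\<^bsub>G\<^esub> V. rep_count G U V x) = card U * card V"
  using sum_rep_count_filter[OF assms, of G "\<lambda>_. True"]
  by (simp add: card_cartesian_product)

lemma trunc_sum_mono:
  assumes "finite U" "finite V" "finite U'" "finite V'" "0 \<le> t"
    and le: "\<And>x. rep_count G U' V' x \<le> rep_count G U V x"
  shows "trunc_sum G t U' V' \<le> trunc_sum G t U V"
proof -
  have sub: "U' <#>\<^bsub>G\<^esub> V' \<subseteq> U <#>\<^bsub>G\<^esub> V"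
  proof
    fix x assume "x \<in> U' <#>\<^bsub>G\<^esub> V'"
    then have "rep_count G U' V' x \<noteq> 0" using rep_count_eq_0_iff assms by metis
    then have "rep_count G U V x \<noteq> 0" using le[of x] by linarith
    then show "x \<in> U <#>\<^bsub>G\<^esub> V" using rep_count_eq_0_iff assms by metis
  qed
  have "trunc_sum G t U' V' \<le> (\<Sum>x\<in>U' <#>\<^bsub>G\<^esub> V'. min t (real (rep_count G U V x)))"
    unfolding trunc_sum_def using le by (intro sum_mono min.mono) auto
  also have "\<dots> \<le> trunc_sum G t U V"
    unfolding trunc_sum_def using assms sub by (intro sum_mono2 finite_set_mult) auto
  finally show ?thesis .
qed

lemma trunc_sum_mono_right:
  assumes "finite U" "finite V" "V' \<subseteq> V" "0 \<le> t"
  shows "trunc_sum G t U V' \<le> trunc_sum G t U V"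
proof (rule trunc_sum_mono)
  show "rep_count G U V' x \<le> rep_count G U V x" for x
    unfolding rep_count_def using assms by (intro card_mono) auto
qed (use assms finite_subset[OF assms(3,2)] in simp_all)

text \<open>A product in \<open>A\<close> contributes at most \<open>t\<close>; the products outside
  \<open>A\<close> contribute at most the number of pairs that produce them. This is how the
  assumption that almost all products lie in \<open>A\<close> enters.\<close>

lemma trunc_sum_le:
  assumes "finite U" "finite V" "finite A" "0 \<le> t"
  shows "trunc_sum G t U V
    \<le> t * card A + card {p \<in> U \<times> V. fst p \<otimes>\<^bsub>G\<^esub> snd p \<notin> A}"
proof -
  let ?S = "U <#>\<^bsub>G\<^esub> V"
  have fin: "finite ?S" using assms by (simp add: finite_set_mult)
  have "trunc_sum G t U V = (\<Sum>x\<in>?S \<inter> A. min t (real (rep_count G U V x)))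
      + (\<Sum>x\<in>?S - A. min t (real (rep_count G U V x)))"
    unfolding trunc_sum_def using fin by (simp add: sum.Int_Diff)
  also have "\<dots> \<le> (\<Sum>x\<in>?S \<inter> A. t) + (\<Sum>x\<in>?S - A. real (rep_count G U V x))"
    by (intro add_mono sum_mono) auto
  also have "(\<Sum>x\<in>?S - A. real (rep_count G U V x))
      = card {p \<in> U \<times> V. fst p \<otimes>\<^bsub>G\<^esub> snd p \<notin> A}"
    using sum_rep_count_filter[OF assms(1,2), of G "\<lambda>x. x \<notin> A"]
    by (simp add: set_diff_eq of_nat_sum[symmetric] del: of_nat_sum)
  also have "(\<Sum>x\<in>?S \<inter> A. t) \<le> t * card A"
    using assms card_mono[of A "?S \<inter> A"] by (simp add: mult.commute mult_left_mono)
  finally show ?thesis by simp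
qed

text \<open>For \<open>t \<le> K\<close> one has \<open>min t r \<ge> (t / K) * (r - r\<^sup>2 / K)\<close>; the lower bound is this inequality summed.\<close>

lemma trunc_sum_ge_energy:
  fixes t K :: real
  assumes "finite U" "finite V" "0 < t" "t \<le> K"
    and en: "energy G U V \<le> K * (card U * card V) / 2"
  shows "t * (card U * card V) / (2 * K) \<le> trunc_sum G t U V"
proof -
  have pt: "t / K * (r - r\<^sup>2 / K) \<le> min t r" if "0 \<le> r" for r :: real
  proof -
    have K: "K > 0" using assms by linarith
    have "t / K * (r - r\<^sup>2 / K) \<le> t / K * r" using assms K by (intro mult_left_mono) auto
    also have "\<dots> \<le> r" using assms K that mult_right_mono[of t K r] by (simp add: field_simps)
    finally have 1: "t / K * (r - r\<^sup>2 / K) \<le> r" .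
    have "0 \<le> (r - K/2)\<^sup>2 + K\<^sup>2*3/4" by simp
    also have "\<dots> = K\<^sup>2 + r\<^sup>2 - K * r" by (simp add: power2_eq_square algebra_simps)
    finally have "K * r - r\<^sup>2 \<le> K\<^sup>2" by simp
    then have "r - r\<^sup>2 / K \<le> K" using K by (simp add: field_simps power2_eq_square)
    then have "t / K * (r - r\<^sup>2 / K) \<le> t / K * K" using assms K by (intro mult_left_mono) auto
    then show ?thesis using 1 K by simp
  qed
  have K: "K > 0" using assms by linarith
  have "t * (card U * card V) / (2 * K) = t / K * (real (card U * card V) - real (card U * card V) / 2)"
    using K by (simp add: field_simps)
  also have "\<dots> \<le> t / K * (card U * card V - energy G U V / K)"
    using en assms K by (intro mult_left_mono) (auto simp: field_simps)
  also have "\<dots> = (\<Sum>x\<in>U <#>\<^bsub>G\<^esub> V. t / K * (real (rep_count G U V x) - (real (rep_count G U V x))\<^sup>2 / K))"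
    unfolding sum_distrib_left[symmetric] sum_subtractf sum_divide_distrib[symmetric]
      sum_rep_count[OF assms(1,2), of G, symmetric] energy_def by simp
  also have "\<dots> \<le> trunc_sum G t U V" unfolding trunc_sum_def by (intro sum_mono pt) simp
  finally show ?thesis .
qed

context comm_group
begin

lemma rep_count_eq_card_right:
  assumes "U \<subseteq> carrier G" "V \<subseteq> carrier G" "x \<in> carrier G"
  shows "rep_count G U V x = card {v \<in> V. x \<otimes> inv v \<in> U}"
  unfolding rep_count_def
proof (rule bij_betw_same_card[of snd])
  show "bij_betw snd {p \<in> U \<times> V. fst p \<otimes> snd p = x} {v \<in> V. x \<otimes> inv v \<in> U}"
  proof (rule bij_betw_byWitness[of _ "\<lambda>v. (x \<otimes> inv v, v)"])
    show "\<forall>a\<in>{p \<in> U \<times> V. fst p \<otimes> snd p = x}. (x \<otimes> inv (snd a), snd a) = a"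
      using assms by (auto simp: m_assoc subset_iff)
    show "snd ` {p \<in> U \<times> V. fst p \<otimes> snd p = x} \<subseteq> {v \<in> V. x \<otimes> inv v \<in> U}"
      using assms by (auto simp: m_assoc subset_iff)
    show "(\<lambda>v. (x \<otimes> inv v, v)) ` {v \<in> V. x \<otimes> inv v \<in> U} \<subseteq> {p \<in> U \<times> V. fst p \<otimes> snd p = x}"
      using assms by (auto simp: m_assoc subset_iff)
  qed auto
qed

text \<open>No product has more than \<open>card V\<close> representations, so
  \<open>min t r \<ge> (t / card V) * r\<close> for \<open>t \<le> card V\<close>. The counts
  \<open>r\<close> add up to \<open>card U * card V\<close>.\<close>

lemma trunc_sum_ge_left:
  fixes t :: real
  assumes "finite U" "finite V" "U \<subseteq> carrier G" "V \<subseteq> carrier G" "0 \<le> t" "t \<le> card V"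
  shows "t * card U \<le> trunc_sum G t U V"
proof (cases "card V = 0")
  case True
  then show ?thesis using assms by (simp add: trunc_sum_def sum_nonneg)
next
  case False
  have pt: "t / card V * real (rep_count G U V x) \<le> min t (real (rep_count G U V x))"
    if "x \<in> U <#> V" for x
  proof -
    have "x \<in> carrier G" using that assms set_mult_closed by blast
    then have "rep_count G U V x \<le> card V"
      using assms by (auto simp: rep_count_eq_card_right intro!: card_mono)
    then have "real (rep_count G U V x) \<le> card V" by simp
    then have "t * real (rep_count G U V x) \<le> t * card V" using assms by (intro mult_left_mono) auto
    moreover have "t * real (rep_count G U V x) \<le> card V * real (rep_count G U V x)"
      using assms by (intro mult_right_mono) auto
    ultimately show ?thesis using False by (simp add: field_simps)
  qed
  have "t * card U = t / card V * real (card U * card V)" using False by simp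
  also have "\<dots> = (\<Sum>x\<in>U <#> V. t / card V * real (rep_count G U V x))"
    unfolding sum_rep_count[OF assms(1,2), of G, symmetric] of_nat_sum sum_distrib_left by simp
  also have "\<dots> \<le> trunc_sum G t U V" unfolding trunc_sum_def by (intro sum_mono pt)
  finally show ?thesis .
qed

section \<open>Dyson transforms\<close>

text \<open>A new pair \<open>(a, w)\<close> has \<open>a = e v\<close> with \<open>v\<close> in
  \<open>V\<close>, while \<open>e w\<close> lies in \<open>U\<close>; hence \<open>(e w, v)\<close>
  is an old pair with the same product. An old pair that is kept cannot coincide with such an image,
  as its second component \<open>w\<close> satisfies \<open>e w \<in> U\<close> whereas
  \<open>e v = a\<close> is not in \<open>U\<close>.\<close>

lemma rep_count_dyson_le:
  assumes "finite U" "finite V" "U \<subseteq> carrier G" "V \<subseteq> carrier G" "e \<in> carrier G"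
  shows "rep_count G (U \<union> (\<otimes>) e ` V) {v \<in> V. e \<otimes> v \<in> U} x \<le> rep_count G U V x"
  unfolding rep_count_def
proof (rule card_inj_on_le)
  let ?f = "\<lambda>(a, w). if a \<in> U then (a, w) else (e \<otimes> w, inv e \<otimes> a)"
  let ?S = "{p \<in> (U \<union> (\<otimes>) e ` V) \<times> {v \<in> V. e \<otimes> v \<in> U}. fst p \<otimes> snd p = x}"
  have c: "inv e \<otimes> (e \<otimes> v) = v" if "v \<in> carrier G" for v
    using assms that by (simp add: m_assoc[symmetric])
  have inV: "v \<in> carrier G" if "v \<in> V" for v using that assms by auto
  show "inj_on ?f ?S"
    using assms by (auto simp: inj_on_def c inV subset_iff split: if_splits)
  show "?f ` ?S \<subseteq> {p \<in> U \<times> V. fst p \<otimes> snd p = x}"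
    using assms by (auto simp: c inV m_ac subset_iff split: if_splits)
  show "finite {p \<in> U \<times> V. fst p \<otimes> snd p = x}" using assms by simp
qed

text \<open>Inclusion-exclusion for \<open>U\<close> and \<open>eV\<close>: translation by
  \<open>e\<close> maps the new second set onto their intersection.\<close>

lemma card_dyson:
  assumes "finite U" "finite V" "V \<subseteq> carrier G" "e \<in> carrier G"
  shows "card (U \<union> (\<otimes>) e ` V) + card {v \<in> V. e \<otimes> v \<in> U} = card U + card V"
proof -
  have inj: "inj_on ((\<otimes>) e) V" using assms by (auto simp: inj_on_def subset_iff)
  have "(\<otimes>) e ` {v \<in> V. e \<otimes> v \<in> U} = U \<inter> (\<otimes>) e ` V" by auto
  then have "card {v \<in> V. e \<otimes> v \<in> U} = card (U \<inter> (\<otimes>) e ` V)"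
    by (metis (no_types, lifting) card_image inj inj_on_subset mem_Collect_eq subsetI)
  moreover have "card U + card ((\<otimes>) e ` V) = card (U \<union> (\<otimes>) e ` V) + card (U \<inter> (\<otimes>) e ` V)"
    using assms by (intro card_Un_Int) auto
  ultimately show ?thesis using inj by (simp add: card_image)
qed

section \<open>Energy bounds from translates and from cosets\<close>

text \<open>In a quadruple with \<open>u v = u' w\<close> the element \<open>u'\<close> is
  determined by the other three.\<close>

lemma energy_eq_card:
  assumes "finite U" "finite V" "U \<subseteq> carrier G" "V \<subseteq> carrier G"
  shows "energy G U V = card {(u, v, w). u \<in> U \<and> v \<in> V \<and> w \<in> V \<and> u \<otimes> v \<otimes> inv w \<in> U}"
proof -
  have fin: "finite (U <#> V)" using assms by (simp add: finite_set_mult)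
  have "energy G U V = (\<Sum>x\<in>U <#> V. \<Sum>p\<in>{p \<in> U \<times> V. fst p \<otimes> snd p = x}. rep_count G U V (fst p \<otimes> snd p))"
    unfolding energy_def
    by (intro sum.cong refl) (simp add: rep_count_def[of _ _ _ "_"] power2_eq_square)
  also have "\<dots> = (\<Sum>p\<in>U \<times> V. rep_count G U V (fst p \<otimes> snd p))"
    using assms fin by (intro sum.group) (auto simp: set_mult_eq_image)
  also have "\<dots> = (\<Sum>p\<in>U \<times> V. card {w \<in> V. fst p \<otimes> snd p \<otimes> inv w \<in> U})"
    using assms by (intro sum.cong refl rep_count_eq_card_right) (auto simp: subset_iff)
  also have "\<dots> = card (SIGMA p:U \<times> V. {w \<in> V. fst p \<otimes> snd p \<otimes> inv w \<in> U})"
    using assms by (simp add: card_SigmaI)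
  also have "\<dots> = card {(u, v, w). u \<in> U \<and> v \<in> V \<and> w \<in> V \<and> u \<otimes> v \<otimes> inv w \<in> U}"
    by (rule bij_betw_same_card[of "\<lambda>((u, v), w). (u, v, w)"],
        rule bij_betw_byWitness[of _ "\<lambda>(u, v, w). ((u, v), w)"]) auto
  finally show ?thesis .
qed

lemma inv_mult_cancel:
  assumes "x \<in> carrier G" "y \<in> carrier G"
  shows "inv x \<otimes> (x \<otimes> y) = y" "x \<otimes> (inv x \<otimes> y) = y"
  using assms by (simp_all add: m_assoc[symmetric])

text \<open>Multiplication by \<open>h\<close> is injective on the finite set \<open>E\<close> and
  maps it to itself, hence is onto, which gives inverses. An orbit map embeds the stabilizer into
  \<open>E\<close>, so it is finite.\<close>

lemma subgroup_stabilizer: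
  assumes "finite E" "E \<noteq> {}" "E \<subseteq> carrier G"
  defines "H \<equiv> {h \<in> carrier G. \<forall>e\<in>E. h \<otimes> e \<in> E}"
  shows "subgroup H G" "finite H"
proof -
  have EG: "e \<in> carrier G" if "e \<in> E" for e using that assms by auto
  have inv: "inv h \<in> H" if h: "h \<in> H" for h
  proof -
    have hG: "h \<in> carrier G" using h by (simp add: H_def)
    have "inj_on ((\<otimes>) h) E" using hG EG by (auto simp: inj_on_def)
    moreover have "(\<otimes>) h ` E \<subseteq> E" using h by (auto simp: H_def)
    ultimately have surj: "(\<otimes>) h ` E = E" using assms(1) by (simp add: endo_inj_surj)
    have "inv h \<otimes> e \<in> E" if "e \<in> E" for e
    proof -
      have "e \<in> (\<otimes>) h ` E" using surj that by simp
      then obtain f where f: "f \<in> E" "e = h \<otimes> f" by auto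
      then have "inv h \<otimes> e = f" using hG EG by (simp add: inv_mult_cancel)
      then show ?thesis using f by simp
    qed
    then show ?thesis using hG by (simp add: H_def)
  qed
  show "subgroup H G"
  proof (rule subgroupI)
    have "\<one> \<in> H" using EG by (simp add: H_def)
    then show "H \<noteq> {}" by blast
    show "a \<otimes> b \<in> H" if "a \<in> H" "b \<in> H" for a b
      using that EG by (auto simp: H_def m_assoc)
  qed (use inv in \<open>auto simp: H_def\<close>)
  obtain e where e: "e \<in> E" using assms(2) by blast
  have "inj_on (\<lambda>h. h \<otimes> e) H" using EG[OF e] by (auto simp: inj_on_def H_def)
  moreover have "(\<lambda>h. h \<otimes> e) ` H \<subseteq> E" using e by (auto simp: H_def)
  ultimately show "finite H" using assms(1) inj_on_finite by blast
qed

text \<open>Fix \<open>u\<close> and \<open>w\<close>: the admissible \<open>v\<close> satisfy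
  \<open>e v \<in> U\<close> for the single element \<open>e = u (inv w)\<close>.\<close>

lemma energy_le_of_translates:
  fixes \<tau> :: real
  assumes "finite U" "finite V" "U \<subseteq> carrier G" "V \<subseteq> carrier G"
    and small: "\<And>e. e \<in> carrier G \<Longrightarrow> card {v \<in> V. e \<otimes> v \<in> U} \<le> \<tau>"
  shows "energy G U V \<le> \<tau> * (card U * card V)"
proof -
  let ?Q = "{(u, v, w). u \<in> U \<and> v \<in> V \<and> w \<in> V \<and> u \<otimes> v \<otimes> inv w \<in> U}"
  let ?R = "SIGMA p:U \<times> V. {v \<in> V. (fst p \<otimes> inv (snd p)) \<otimes> v \<in> U}"
  have UG: "u \<in> carrier G" if "u \<in> U" for u using that assms by auto
  have VG: "v \<in> carrier G" if "v \<in> V" for v using that assms by auto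
  have "card ?Q \<le> card ?R"
  proof (rule card_inj_on_le[of "\<lambda>(u, v, w). ((u, w), v)"])
    show "inj_on (\<lambda>(u, v, w). ((u, w), v)) ?Q" by (auto simp: inj_on_def)
    have "u \<otimes> inv w \<otimes> v \<in> U" if "u \<in> U" "v \<in> V" "w \<in> V" "u \<otimes> v \<otimes> inv w \<in> U" for u v w
      using that UG VG by (simp add: m_ac)
    then show "(\<lambda>(u, v, w). ((u, w), v)) ` ?Q \<subseteq> ?R" by auto
    show "finite ?R" using assms by simp
  qed
  then have "real (energy G U V) \<le> real (card ?R)" using energy_eq_card[OF assms(1-4)] by simp
  also have "\<dots> = (\<Sum>p\<in>U \<times> V. real (card {v \<in> V. (fst p \<otimes> inv (snd p)) \<otimes> v \<in> U}))"
    using assms by (simp add: card_SigmaI)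
  also have "\<dots> \<le> (\<Sum>p\<in>U \<times> V. \<tau>)"
    by (intro sum_mono small) (auto simp: UG VG)
  also have "\<dots> = \<tau> * (card U * card V)" by (simp add: card_cartesian_product)
  finally show ?thesis .
qed

text \<open>Split the triples by whether \<open>v (inv w)\<close> lies in \<open>H\<close>. If it
  does, \<open>u\<close> and \<open>v\<close> are free and \<open>w\<close> lies in the coset of
  \<open>v\<close>, which gives the term with \<open>\<sigma>\<close>. Otherwise fix
  \<open>u\<close> and \<open>u' = u v (inv w)\<close>: then \<open>d = (inv u) u'\<close> is
  outside \<open>H\<close> and \<open>d w = v\<close> is in \<open>V\<close>, which gives the term
  with \<open>\<tau>\<close>.\<close>

lemma energy_le_of_cosets:
  fixes \<sigma> \<tau> :: real
  assumes "finite U" "finite V" "U \<subseteq> carrier G" "V \<subseteq> carrier G" "0 \<le> \<tau>"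
    and small: "\<And>d. d \<in> carrier G \<Longrightarrow> d \<notin> H \<Longrightarrow> card {v \<in> V. d \<otimes> v \<in> V} \<le> \<tau>"
    and cosets: "\<And>v. v \<in> V \<Longrightarrow> card {w \<in> V. v \<otimes> inv w \<in> H} \<le> \<sigma>"
  shows "energy G U V \<le> \<sigma> * (card U * card V) + \<tau> * (card U * card U)"
proof -
  let ?Q = "{(u, v, w). u \<in> U \<and> v \<in> V \<and> w \<in> V \<and> u \<otimes> v \<otimes> inv w \<in> U}"
  let ?Q1 = "{(u, v, w). u \<in> U \<and> v \<in> V \<and> w \<in> V \<and> v \<otimes> inv w \<in> H}"
  let ?Q2 = "{(u, v, w). u \<in> U \<and> v \<in> V \<and> w \<in> V \<and> u \<otimes> v \<otimes> inv w \<in> U \<and> v \<otimes> inv w \<notin> H}"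
  have UG: "u \<in> carrier G" if "u \<in> U" for u using that assms by auto
  have VG: "v \<in> carrier G" if "v \<in> V" for v using that assms by auto
  have Q1: "?Q1 = U \<times> (SIGMA v:V. {w \<in> V. v \<otimes> inv w \<in> H})" by auto
  have fin1: "finite ?Q1" unfolding Q1 using assms by simp
  have fin2: "finite ?Q2"
    by (rule finite_subset[of _ "U \<times> V \<times> V"]) (use assms in auto)
  have "card ?Q1 = card U * (\<Sum>v\<in>V. card {w \<in> V. v \<otimes> inv w \<in> H})"
    unfolding Q1 card_cartesian_product using assms by (simp add: card_SigmaI)
  then have "real (card ?Q1) = card U * (\<Sum>v\<in>V. real (card {w \<in> V. v \<otimes> inv w \<in> H}))"
    by simp
  also have "\<dots> \<le> card U * (\<Sum>v\<in>V. \<sigma>)"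
    by (intro mult_left_mono sum_mono cosets) auto
  finally have c1: "real (card ?Q1) \<le> \<sigma> * (card U * card V)" by (simp add: mult_ac)
  define D where "D u u' = (if inv u \<otimes> u' \<in> H then {} else {w \<in> V. (inv u \<otimes> u') \<otimes> w \<in> V})" for u u'
  let ?R = "SIGMA p:U \<times> U. D (fst p) (snd p)"
  have finD: "finite (D u u')" for u u' using assms by (simp add: D_def)
  have "card ?Q2 \<le> card ?R"
  proof (rule card_inj_on_le[of "\<lambda>(u, v, w). ((u, u \<otimes> v \<otimes> inv w), w)"])
    have can: "v = v'" if "u \<in> U" "v \<in> V" "v' \<in> V" "w \<in> V" "u \<otimes> v \<otimes> inv w = u \<otimes> v' \<otimes> inv w" for u v v' w
      using that UG VG by simp
    show "inj_on (\<lambda>(u, v, w). ((u, u \<otimes> v \<otimes> inv w), w)) ?Q2"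
      unfolding inj_on_def using can by auto
    have "w \<in> D u (u \<otimes> v \<otimes> inv w)"
      if "u \<in> U" "v \<in> V" "w \<in> V" "u \<otimes> v \<otimes> inv w \<in> U" "v \<otimes> inv w \<notin> H" for u v w
    proof -
      have "inv u \<otimes> (u \<otimes> v \<otimes> inv w) = v \<otimes> inv w"
        using that UG VG by (simp add: m_assoc inv_mult_cancel)
      moreover have "v \<otimes> inv w \<otimes> w = v" using that VG by (simp add: m_assoc)
      ultimately show ?thesis using that by (simp add: D_def)
    qed
    then show "(\<lambda>(u, v, w). ((u, u \<otimes> v \<otimes> inv w), w)) ` ?Q2 \<subseteq> ?R" by auto
    show "finite ?R" using assms finD by simp
  qed
  then have "real (card ?Q2) \<le> real (card ?R)" by simp
  also have "\<dots> = (\<Sum>p\<in>U \<times> U. real (card (D (fst p) (snd p))))"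
    using assms finD by (simp add: card_SigmaI)
  also have "\<dots> \<le> (\<Sum>p\<in>U \<times> U. \<tau>)"
    using small assms(5) by (intro sum_mono) (auto simp: D_def UG)
  also have "\<dots> = \<tau> * (card U * card U)" by (simp add: card_cartesian_product)
  finally have c2: "real (card ?Q2) \<le> \<tau> * (card U * card U)" .
  have "card ?Q \<le> card (?Q1 \<union> ?Q2)"
    using fin1 fin2 by (intro card_mono) auto
  also have "\<dots> \<le> card ?Q1 + card ?Q2" by (rule card_Un_le)
  finally have "real (card ?Q) \<le> real (card ?Q1) + real (card ?Q2)" by simp
  then show ?thesis using c1 c2 energy_eq_card[OF assms(1-4)] by simp
qed

text \<open>The quotient of an element of the first piece by one of the second lies in the coset
  \<open>v (inv v') H\<close>. This coset has \<open>card H\<close> elements, none of them in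
  \<open>H\<close>, and each is a quotient of at most \<open>\<tau>\<close> pairs.\<close>

lemma card_coset_pieces_le:
  fixes \<tau> :: real
  assumes "finite V" "V \<subseteq> carrier G" "subgroup H G" "finite H"
    and small: "\<And>d. d \<in> carrier G \<Longrightarrow> d \<notin> H \<Longrightarrow> card {v \<in> V. d \<otimes> v \<in> V} \<le> \<tau>"
    and v: "v \<in> V" "v' \<in> V" "v \<otimes> inv v' \<notin> H"
  shows "real (card {w \<in> V. v \<otimes> inv w \<in> H}) * card {w \<in> V. v' \<otimes> inv w \<in> H} \<le> \<tau> * card H"
proof -
  interpret H: subgroup H G by fact
  let ?A = "{w \<in> V. v \<otimes> inv w \<in> H}" and ?B = "{w \<in> V. v' \<otimes> inv w \<in> H}"
  let ?R = "SIGMA h:H. {b \<in> V. (v \<otimes> inv v' \<otimes> h) \<otimes> b \<in> V}"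
  let ?f = "\<lambda>(a, b). (v' \<otimes> inv b \<otimes> inv (v \<otimes> inv a), b)"
  have VG: "v \<in> carrier G" if "v \<in> V" for v using that assms by auto
  have key: "v \<otimes> inv v' \<otimes> (v' \<otimes> inv b \<otimes> inv (v \<otimes> inv a)) \<otimes> b = a"
    if "a \<in> V" "b \<in> V" for a b
  proof -
    have "a \<otimes> (inv v \<otimes> b) = b \<otimes> (inv v \<otimes> a)" using that v VG by (simp add: m_ac)
    moreover have "v \<otimes> inv v' \<otimes> (v' \<otimes> inv b \<otimes> inv (v \<otimes> inv a)) \<otimes> b
        = v \<otimes> (inv b \<otimes> (a \<otimes> (inv v \<otimes> b)))"
      using that v VG by (simp add: inv_mult_group m_assoc inv_mult_cancel)
    ultimately show ?thesis using that v VG by (simp add: inv_mult_cancel)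
  qed
  have "card (?A \<times> ?B) \<le> card ?R"
  proof (rule card_inj_on_le[of ?f])
    show "inj_on ?f (?A \<times> ?B)"
      by (rule inj_on_inverseI[of _ "\<lambda>(h, b). (v \<otimes> inv v' \<otimes> h \<otimes> b, b)"]) (auto simp: key)
    show "?f ` (?A \<times> ?B) \<subseteq> ?R" by (auto simp: key)
    show "finite ?R" using assms by simp
  qed
  then have "real (card ?A) * card ?B \<le> real (card ?R)"
    by (simp add: card_cartesian_product flip: of_nat_mult)
  also have "\<dots> = (\<Sum>h\<in>H. real (card {b \<in> V. (v \<otimes> inv v' \<otimes> h) \<otimes> b \<in> V}))"
    using assms by (simp add: card_SigmaI)
  also have "\<dots> \<le> (\<Sum>h\<in>H. \<tau>)"
  proof (intro sum_mono small)
    fix h assume h: "h \<in> H"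
    then show "v \<otimes> inv v' \<otimes> h \<in> carrier G" using v VG by simp
    show "v \<otimes> inv v' \<otimes> h \<notin> H"
    proof
      assume "v \<otimes> inv v' \<otimes> h \<in> H"
      then have "v \<otimes> inv v' \<otimes> h \<otimes> inv h \<in> H" using h by simp
      then show False using v VG h by (simp add: m_assoc)
    qed
  qed
  finally show ?thesis by (simp add: mult.commute)
qed

section \<open>The robust Kneser theorem\<close>

text \<open>The end of the transform process: every transform that would change \<open>V\<close>
  leaves fewer than \<open>\<tau>\<close> elements. There are two ways to conclude: either
  \<open>V\<close> is hardly larger than a subgroup \<open>H\<close> and the bound
  \<open>\<tau> * card U\<close> suffices, or a part of \<open>V\<close> with at least
  \<open>\<eta> * N\<close> elements has small energy with \<open>U\<close>.\<close>

lemma trunc_sum_kneser_stuck: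
  fixes \<eta> N \<tau> :: real
  defines "\<tau> \<equiv> \<eta> ^ 4 * N / 2048"
  assumes fin: "finite U" "finite V" and sub: "U \<subseteq> carrier G" "V \<subseteq> carrier G"
    and \<eta>: "0 < \<eta>" "\<eta> \<le> 1" and N: "0 < N"
    and V: "\<tau> \<le> card V" and U: "N \<le> card U" and UV: "real (card U) + card V \<le> 2 * N"
    and stuck: "\<And>e. e \<in> carrier G \<Longrightarrow> \<not> (\<lambda>v. e \<otimes> v) ` V \<subseteq> U \<Longrightarrow> card {v \<in> V. e \<otimes> v \<in> U} < \<tau>"
  shows "\<exists>H. subgroup H G \<and> finite H \<and> \<tau> * card H \<le> trunc_sum G \<tau> U V \<and>
     \<tau> * (real (card U) + card V - card H - \<eta> * N) \<le> trunc_sum G \<tau> U V"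
proof -
  have \<tau>: "0 < \<tau>" using \<eta> N by (simp add: \<tau>_def)
  have p: "\<eta> ^ 4 \<le> \<eta>" "\<eta> ^ 3 \<le> \<eta>" "\<eta>\<^sup>2 \<le> \<eta>"
    using \<eta> power_decreasing[of 1 4 \<eta>] power_decreasing[of 1 3 \<eta>] power_decreasing[of 1 2 \<eta>] by auto
  have pN: "\<eta> ^ 4 * N \<le> \<eta> * N" "\<eta> ^ 3 * N \<le> \<eta> * N" "\<eta>\<^sup>2 * N \<le> \<eta> * N" "0 < \<eta> * N"
    using p N \<eta> by (auto intro: mult_right_mono)
  \<comment> \<open>With this value
    \<open>card U * card W \<ge> N * (\<eta> * N) = 4 * K * N\<close>. The energy bound for the
    truncated sum then gives \<open>\<tau> * (2 * N)\<close>, which covers the whole of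
    \<open>card U + card V\<close>.\<close>
  define K where "K = \<eta> * N / 4"
  have K: "\<tau> \<le> K / 2" "0 < K" "\<tau> \<le> K" using pN \<eta> N by (auto simp: K_def \<tau>_def)
  have left: "\<tau> * card U \<le> trunc_sum G \<tau> U V"
    using trunc_sum_ge_left[OF fin sub] \<tau> V by simp
  have Upos: "1 \<le> card U" using U N by (cases "card U") auto
  have done_if_small: ?thesis
    if "subgroup H G" "finite H" "card H \<le> card U" "card V \<le> card H + \<eta> * N" for H
  proof (intro exI[of _ H] conjI)
    have "\<tau> * card H \<le> \<tau> * card U" using that \<tau> by (intro mult_left_mono) auto
    then show "\<tau> * card H \<le> trunc_sum G \<tau> U V" using left by simp
    have "\<tau> * (real (card U) + card V - card H - \<eta> * N) \<le> \<tau> * card U"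
      using that \<tau> by (intro mult_left_mono) auto
    then show "\<tau> * (real (card U) + card V - card H - \<eta> * N) \<le> trunc_sum G \<tau> U V"
      using left by simp
  qed (use that in auto)
  have done_if_energy: ?thesis
    if W: "W \<subseteq> V" "\<eta> * N \<le> card W" and en: "energy G U W \<le> K * (card U * card W) / 2" for W
  proof (intro exI[of _ "{\<one>}"] conjI)
    have "\<tau> * 1 \<le> \<tau> * card U" using Upos \<tau> by (intro mult_left_mono) auto
    then show "\<tau> * card {\<one>} \<le> trunc_sum G \<tau> U V" using left by simp
    have finW: "finite W" using W fin finite_subset by blast
    have "N * (\<eta> * N) \<le> real (card U) * card W"
      using U W pN N by (intro mult_mono) auto
    then have "2 * N \<le> (card U * card W) / (2 * K)"
      using K N \<eta> by (simp add: K_def field_simps)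
    then have "real (card U) + card V - card {\<one>} - \<eta> * N \<le> (card U * card W) / (2 * K)"
      using UV pN by simp
    then have "\<tau> * (real (card U) + card V - card {\<one>} - \<eta> * N) \<le> \<tau> * ((card U * card W) / (2 * K))"
      using \<tau> by (intro mult_left_mono) auto
    also have "\<dots> \<le> trunc_sum G \<tau> U W"
      using trunc_sum_ge_energy[OF fin(1) finW \<tau> K(3) en] by simp
    also have "\<dots> \<le> trunc_sum G \<tau> U V" using fin W \<tau> by (intro trunc_sum_mono_right) auto
    finally show "\<tau> * (real (card U) + card V - card {\<one>} - \<eta> * N) \<le> trunc_sum G \<tau> U V" .
  qed (auto simp: triv_subgroup)
  \<comment> \<open>These are the translations whose transform leaves \<open>V\<close> unchanged, so
    the stuck condition says nothing about them.\<close>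
  define E where "E = {e \<in> carrier G. (\<lambda>v. e \<otimes> v) ` V \<subseteq> U}"
  show ?thesis
  proof (cases "card V \<le> \<eta> * N")
    case True
    then show ?thesis using Upos by (intro done_if_small[of "{\<one>}"]) (auto simp: triv_subgroup)
  next
    case bigV: False
    show ?thesis
    proof (cases "E = {}")
      case True
      have "energy G U V \<le> \<tau> * (card U * card V)"
      proof (rule energy_le_of_translates[OF fin sub])
        fix e assume "e \<in> carrier G"
        then show "card {v \<in> V. e \<otimes> v \<in> U} \<le> \<tau>"
          using stuck[of e] True by (auto simp: E_def intro: less_imp_le)
      qed
      also have "\<dots> \<le> K / 2 * (card U * card V)" using K by (intro mult_right_mono) auto
      finally show ?thesis using bigV by (intro done_if_energy[of V]) auto
    next
      case False
      have VG: "v \<in> carrier G" if "v \<in> V" for v using that sub by auto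
      have "V \<noteq> {}" using V \<tau> by auto
      then obtain v0 where v0: "v0 \<in> V" by blast
      have "E \<subseteq> (\<lambda>u. u \<otimes> inv v0) ` U"
      proof
        fix e assume e: "e \<in> E"
        then have "e \<otimes> v0 \<in> U" "e = e \<otimes> v0 \<otimes> inv v0" using v0 VG by (auto simp: E_def m_assoc)
        then show "e \<in> (\<lambda>u. u \<otimes> inv v0) ` U" by blast
      qed
      then have finE: "finite E" using fin finite_surj by blast
      define H where "H = {h \<in> carrier G. \<forall>e\<in>E. h \<otimes> e \<in> E}"
      have H: "subgroup H G" "finite H"
        unfolding H_def using finE False by (intro subgroup_stabilizer; auto simp: E_def)+
      interpret H: subgroup H G by fact
      obtain e0 where e0: "e0 \<in> E" using False by blast
      have HU: "card H \<le> card U"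
      proof (rule card_inj_on_le[of "\<lambda>h. h \<otimes> e0 \<otimes> v0"])
        show "inj_on (\<lambda>h. h \<otimes> e0 \<otimes> v0) H"
          using e0 v0 VG H.mem_carrier by (auto simp: inj_on_def E_def)
        show "(\<lambda>h. h \<otimes> e0 \<otimes> v0) ` H \<subseteq> U"
        proof
          fix y assume "y \<in> (\<lambda>h. h \<otimes> e0 \<otimes> v0) ` H"
          then obtain h where h: "h \<in> H" "y = h \<otimes> e0 \<otimes> v0" by blast
          then have "h \<otimes> e0 \<in> E" using e0 unfolding H_def by blast
          then show "y \<in> U" using v0 h by (auto simp: E_def)
        qed
      qed (rule fin)
      have small: "card {v \<in> V. d \<otimes> v \<in> V} \<le> \<tau>" if d: "d \<in> carrier G" "d \<notin> H" for d
      proof -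
        \<comment> \<open>Some \<open>e\<close> in \<open>E\<close> is moved out of \<open>E\<close>
          by \<open>d\<close>, so the stuck condition applies to \<open>d e\<close>. Since
          \<open>e V \<subseteq> U\<close>, every \<open>v\<close> with \<open>v\<close> and
          \<open>d v\<close> in \<open>V\<close> is counted there.\<close>
        obtain e where e: "e \<in> E" "d \<otimes> e \<notin> E" using d unfolding H_def by blast
        have eG: "e \<in> carrier G" using e by (simp add: E_def)
        have "{v \<in> V. d \<otimes> v \<in> V} \<subseteq> {v \<in> V. d \<otimes> e \<otimes> v \<in> U}"
        proof clarify
          fix v assume v: "v \<in> V" "d \<otimes> v \<in> V"
          then have "e \<otimes> (d \<otimes> v) \<in> U" using e by (auto simp: E_def)
          moreover have "e \<otimes> (d \<otimes> v) = d \<otimes> e \<otimes> v" using d eG v VG by (simp add: m_ac)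
          ultimately show "d \<otimes> e \<otimes> v \<in> U" by simp
        qed
        then have "card {v \<in> V. d \<otimes> v \<in> V} \<le> card {v \<in> V. d \<otimes> e \<otimes> v \<in> U}"
          using fin by (intro card_mono) auto
        moreover have "card {v \<in> V. d \<otimes> e \<otimes> v \<in> U} < \<tau>"
          using stuck[of "d \<otimes> e"] e d eG by (simp add: E_def)
        ultimately show ?thesis by linarith
      qed
      \<comment> \<open>The part of \<open>V\<close> in the coset of \<open>v\<close> modulo
        \<open>H\<close>. The largest piece is split off; it has at most \<open>card H\<close>
        elements.\<close>
      define piece where "piece v = {w \<in> V. v \<otimes> inv w \<in> H}" for v
      have finp: "finite (piece v)" for v using fin by (simp add: piece_def)
      obtain v1 where v1: "v1 \<in> V" "\<And>v. v \<in> V \<Longrightarrow> card (piece v) \<le> card (piece v1)"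
      proof -
        let ?c = "\<lambda>v. card (piece v)"
        have "Max (?c ` V) \<in> ?c ` V" using fin \<open>V \<noteq> {}\<close> by (intro Max_in) auto
        then obtain v where v: "v \<in> V" "Max (?c ` V) = ?c v" by (rule imageE)
        have "?c w \<le> ?c v" if "w \<in> V" for w
          unfolding v(2)[symmetric] using fin that by (intro Max_ge) auto
        then show ?thesis using that v(1) by blast
      qed
      have "card (piece v1) \<le> card H"
      proof (rule card_inj_on_le[of "\<lambda>w. v1 \<otimes> inv w"])
        show "inj_on (\<lambda>w. v1 \<otimes> inv w) (piece v1)"
        proof (rule inj_onI)
          fix a b assume ab: "a \<in> piece v1" "b \<in> piece v1" "v1 \<otimes> inv a = v1 \<otimes> inv b"
          then have "inv a = inv b" using v1 VG by (simp add: piece_def)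
          then show "a = b" using ab VG inv_inv by (metis (no_types, lifting) mem_Collect_eq piece_def)
        qed
      qed (use H in \<open>auto simp: piece_def\<close>)
      define W where "W = V - piece v1"
      have cardV: "card V = card (piece v1) + card W"
      proof -
        have "piece v1 \<subseteq> V" by (auto simp: piece_def)
        then show ?thesis unfolding W_def
          using fin finp[of v1] card_mono[of V "piece v1"] by (simp add: card_Diff_subset)
      qed
      show ?thesis
      proof (cases "card W \<le> \<eta> * N")
        case True
        then show ?thesis using H HU cardV \<open>card (piece v1) \<le> card H\<close>
          by (intro done_if_small[of H]) auto
      next
        case bigW: False
        \<comment> \<open>Chosen so that \<open>\<sigma>\<^sup>2 = \<tau> * (2 * N)\<close>, which
          accounts for \<open>2048 = 2 * 32\<^sup>2\<close> in \<open>\<tau>\<close>. Two different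
          pieces have product of sizes at most
          \<open>\<tau> * card H \<le> \<sigma>\<^sup>2\<close>, so any piece other than the largest
          has at most \<open>\<sigma>\<close> elements.\<close>
        define \<sigma> where "\<sigma> = \<eta>\<^sup>2 * N / 32"
        have W: "finite W" "W \<subseteq> carrier G" "W \<subseteq> V" using fin sub by (auto simp: W_def)
        have smallpiece: "card {w \<in> W. v \<otimes> inv w \<in> H} \<le> \<sigma>" if v: "v \<in> W" for v
        proof -
          have "v \<otimes> inv v1 \<notin> H"
          proof
            assume "v \<otimes> inv v1 \<in> H"
            then have "inv (v \<otimes> inv v1) \<in> H" by simp
            then have "v1 \<otimes> inv v \<in> H" using v v1 W VG by (simp add: inv_mult_group subset_iff)
            then show False using v by (auto simp: W_def piece_def)
          qed
          then have le: "real (card (piece v)) * card (piece v1) \<le> \<tau> * card H"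
            using card_coset_pieces_le[OF fin(2) sub(2) H small, of v v1] v v1 W
            by (auto simp: piece_def)
          have vV: "v \<in> V" using v W by auto
          have "(real (card (piece v)))\<^sup>2 \<le> real (card (piece v)) * card (piece v1)"
            unfolding power2_eq_square using v1(2)[OF vV] by (intro mult_left_mono) auto
          also have "\<dots> \<le> \<tau> * (2 * N)"
            using le HU UV \<tau> mult_left_mono[of "real (card H)" "2 * N" \<tau>] by linarith
          also have "\<dots> = \<sigma>\<^sup>2" by (simp add: \<tau>_def \<sigma>_def power2_eq_square power4_eq_xxxx field_simps)
          finally have "real (card (piece v)) \<le> \<sigma>"
            by (rule power2_le_imp_le) (use N in \<open>simp add: \<sigma>_def\<close>)
          moreover have "card {w \<in> W. v \<otimes> inv w \<in> H} \<le> card (piece v)"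
            using W finp by (intro card_mono) (auto simp: piece_def)
          ultimately show ?thesis by linarith
        qed
        have smallW: "card {v \<in> W. d \<otimes> v \<in> W} \<le> \<tau>" if d: "d \<in> carrier G" "d \<notin> H" for d
        proof -
          have "card {v \<in> W. d \<otimes> v \<in> W} \<le> card {v \<in> V. d \<otimes> v \<in> V}"
            using fin W by (intro card_mono) auto
          then show ?thesis using small[OF d] by linarith
        qed
        have "energy G U W \<le> \<sigma> * (card U * card W) + \<tau> * (card U * card U)"
          using energy_le_of_cosets[OF fin(1) W(1) sub(1) W(2) _ smallW smallpiece] \<tau> by simp
        \<comment> \<open>One factor \<open>card U \<le> 2 * N\<close> is traded for
          \<open>card W\<close>, which exceeds \<open>\<eta> * N\<close>; this costs a power of
          \<open>\<eta>\<close>.\<close>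
        also have "\<tau> * (card U * card U) \<le> \<eta> ^ 3 * N / 1024 * (card U * card W)"
        proof -
          have "\<tau> * card U \<le> \<tau> * (2 * N)" using UV \<tau> by (intro mult_left_mono) auto
          also have "\<dots> = \<eta> ^ 3 * N / 1024 * (\<eta> * N)"
            by (simp add: \<tau>_def power3_eq_cube power4_eq_xxxx)
          also have "\<dots> \<le> \<eta> ^ 3 * N / 1024 * card W"
            using bigW \<eta> N by (intro mult_left_mono) auto
          finally have "\<tau> * card U * card U \<le> \<eta> ^ 3 * N / 1024 * card W * card U"
            by (intro mult_right_mono) auto
          then show ?thesis by (simp add: mult_ac)
        qed
        also have "\<sigma> * (card U * card W) + \<eta> ^ 3 * N / 1024 * (card U * card W)
            = (\<sigma> + \<eta> ^ 3 * N / 1024) * (card U * card W)" by (simp add: algebra_simps)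
        also have "\<dots> \<le> K / 2 * (card U * card W)"
        proof (rule mult_right_mono)
          show "\<sigma> + \<eta> ^ 3 * N / 1024 \<le> K / 2" unfolding \<sigma>_def K_def using pN by linarith
        qed simp
        finally show ?thesis using bigW W by (intro done_if_energy[of W]) auto
      qed
    qed
  qed
qed

text \<open>Strong induction on \<open>card V\<close>. A transform that changes \<open>V\<close> and
  keeps at least \<open>\<tau>\<close> of its elements preserves \<open>card U + card V\<close> and
  all hypotheses, and it does not increase the truncated sum.\<close>

lemma trunc_sum_kneser:
  fixes \<eta> N \<tau> :: real
  defines "\<tau> \<equiv> \<eta> ^ 4 * N / 2048"
  assumes "finite U" "finite V" "U \<subseteq> carrier G" "V \<subseteq> carrier G"
    and \<eta>: "0 < \<eta>" "\<eta> \<le> 1" and N: "0 < N"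
    and "\<tau> \<le> card V" "N \<le> card U" "real (card U) + card V \<le> 2 * N"
  shows "\<exists>H. subgroup H G \<and> finite H \<and> \<tau> * card H \<le> trunc_sum G \<tau> U V \<and>
     \<tau> * (real (card U) + card V - card H - \<eta> * N) \<le> trunc_sum G \<tau> U V"
  using assms(2-5,9-)
proof (induction "card V" arbitrary: U V rule: less_induct)
  case less
  have \<tau>: "0 < \<tau>" using \<eta> N by (simp add: \<tau>_def)
  show ?case
  proof (cases "\<exists>e\<in>carrier G. \<not> (\<lambda>v. e \<otimes> v) ` V \<subseteq> U \<and> \<tau> \<le> card {v \<in> V. e \<otimes> v \<in> U}")
    case False
    then show ?thesis
      unfolding \<tau>_def using less.prems \<eta> N
      by (intro trunc_sum_kneser_stuck) (auto simp: \<tau>_def not_le)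
  next
    case True
    then obtain e where e: "e \<in> carrier G" "\<not> (\<lambda>v. e \<otimes> v) ` V \<subseteq> U" "\<tau> \<le> card {v \<in> V. e \<otimes> v \<in> U}"
      by blast
    let ?U = "U \<union> (\<otimes>) e ` V" and ?V = "{v \<in> V. e \<otimes> v \<in> U}"
    have card: "card ?U + card ?V = card U + card V"
      using less.prems e by (intro card_dyson) auto
    then have cardr: "real (card ?U) + card ?V = real (card U) + card V"
      by (metis of_nat_add)
    have "card ?V < card V" using less.prems e by (intro psubset_card_mono) auto
    moreover have "card U \<le> card ?U" using less.prems by (intro card_mono) auto
    ultimately have "\<exists>H. subgroup H G \<and> finite H \<and> \<tau> * card H \<le> trunc_sum G \<tau> ?U ?V \<and>
       \<tau> * (real (card ?U) + card ?V - card H - \<eta> * N) \<le> trunc_sum G \<tau> ?U ?V"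
      using less.prems e cardr by (intro less.hyps) (auto simp: subset_iff)
    moreover have "trunc_sum G \<tau> ?U ?V \<le> trunc_sum G \<tau> U V"
    proof (rule trunc_sum_mono)
      show "rep_count G ?U ?V x \<le> rep_count G U V x" for x
        using less.prems e by (intro rep_count_dyson_le) auto
    qed (use less.prems \<tau> in auto)
    ultimately show ?thesis unfolding cardr by (meson order_trans)
  qed
qed

text \<open>Compare the lower bound for the truncated sum with the upper bound
  \<open>\<tau> * card A\<close> plus the number of bad pairs. The constant
  \<open>\<eta> ^ 5 / 2048\<close> makes the latter at most \<open>\<tau> * (\<eta> * N)\<close>, so
  dividing by \<open>\<tau>\<close> leaves an error \<open>\<eta> * N\<close> only.\<close>

lemma robust_kneser:
  fixes \<eta> :: real
  assumes fin: "finite U" "finite V" "finite A" and sub: "U \<subseteq> carrier G" "V \<subseteq> carrier G"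
    and \<eta>: "0 < \<eta>" "\<eta> \<le> 1" and VU: "V \<noteq> {}" "card V \<le> card U"
    and bad: "card {p \<in> U \<times> V. fst p \<otimes> snd p \<notin> A} \<le> \<eta> ^ 5 / 2048 * (card U * card V)"
  shows "\<exists>H. subgroup H G \<and> finite H \<and> card H \<le> (1 + 2 * \<eta>) * card A \<and>
     real (card U) + card V \<le> (1 + 4 * \<eta>) * (real (card A) + card H)"
proof -
  define N where "N = real (card U)"
  define \<epsilon> where "\<epsilon> = \<eta> ^ 5 / 2048"
  define \<tau> where "\<tau> = \<eta> ^ 4 * N / 2048"
  have p: "\<eta> ^ 4 \<le> \<eta>" "\<eta> ^ 5 \<le> \<eta>"
    using \<eta> power_decreasing[of 1 4 \<eta>] power_decreasing[of 1 5 \<eta>] by auto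
  have \<epsilon>: "0 < \<epsilon>" "\<epsilon> \<le> \<eta> / 2048" using p \<eta> by (auto simp: \<epsilon>_def)
  have cV: "0 < real (card V)" using VU fin by (simp add: card_gt_0_iff)
  then have N: "0 < N" using VU by (simp add: N_def)
  have \<tau>: "0 < \<tau>" using N \<eta> by (simp add: \<tau>_def)
  \<comment> \<open>Truncation at \<open>card V\<close> truncates nothing; it yields that
    \<open>A\<close> is almost as large as \<open>U\<close>, and the errors in \<open>N\<close>
    become errors in \<open>card A\<close>.\<close>
  have "card V * N \<le> card V * card A + \<epsilon> * (N * card V)"
    using trunc_sum_ge_left[OF fin(1,2) sub, of "card V"] trunc_sum_le[OF fin, of "card V" G] bad
    by (simp add: N_def \<epsilon>_def)
  then have "card V * (N * (1 - \<epsilon>)) \<le> card V * real (card A)" by (simp add: algebra_simps)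
  then have NA: "N * (1 - \<epsilon>) \<le> card A" using cV by simp
  have "N * (1/2) \<le> N * (1 - \<epsilon>)" using \<epsilon> \<eta> N by (intro mult_left_mono) auto
  then have N2: "N \<le> 2 * card A" using NA by simp
  show ?thesis
  proof (cases "card V \<le> \<eta> * N")
    case True
    \<comment> \<open>Here \<open>V\<close> itself is within the error term and may be too small for
      the level \<open>\<tau>\<close>; the trivial subgroup serves.\<close>
    show ?thesis
    proof (intro exI[of _ "{\<one>}"] conjI)
      have "0 < card A" using N2 N by simp
      then have "1 \<le> real (card A)" by simp
      moreover have "0 \<le> 2 * \<eta> * card A" using \<eta> by simp
      ultimately show "card {\<one>} \<le> (1 + 2 * \<eta>) * card A" by (simp add: algebra_simps)
      have "\<epsilon> * \<eta> \<le> \<epsilon> * 1" using \<epsilon> \<eta> by (intro mult_left_mono) auto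
      moreover have "(1 + 4 * \<eta>) * (1 - \<epsilon>) = 1 + 4 * \<eta> - \<epsilon> - 4 * (\<epsilon> * \<eta>)"
        by (simp add: algebra_simps)
      ultimately have "1 + \<eta> \<le> (1 + 4 * \<eta>) * (1 - \<epsilon>)" using \<epsilon> by linarith
      then have "(1 + \<eta>) * N \<le> (1 + 4 * \<eta>) * (1 - \<epsilon>) * N" using N by (intro mult_right_mono) auto
      also have "\<dots> = (1 + 4 * \<eta>) * (N * (1 - \<epsilon>))" by simp
      also have "\<dots> \<le> (1 + 4 * \<eta>) * (real (card A) + card {\<one>})"
        using NA \<eta> by (intro mult_left_mono) auto
      finally show "real (card U) + card V \<le> (1 + 4 * \<eta>) * (real (card A) + card {\<one>})"
        using True by (simp add: N_def algebra_simps)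
    qed (auto simp: triv_subgroup)
  next
    case False
    have "\<eta> ^ 4 * N \<le> \<eta> * N" "0 < \<eta> * N" using p N \<eta> by auto
    then have "\<tau> \<le> card V" using False by (simp add: \<tau>_def)
    then obtain H where H: "subgroup H G" "finite H" "\<tau> * card H \<le> trunc_sum G \<tau> U V"
       "\<tau> * (real (card U) + card V - card H - \<eta> * N) \<le> trunc_sum G \<tau> U V"
      using trunc_sum_kneser[OF fin(1,2) sub \<eta> N] VU by (auto simp: \<tau>_def N_def)
    have "\<epsilon> * (card U * card V) \<le> \<epsilon> * (N * N)"
      using \<epsilon> VU mult_left_mono[of "real (card V)" "real (card U)" "real (card U)"]
      by (intro mult_left_mono) (simp_all add: N_def)
    also have "\<dots> = \<tau> * (\<eta> * N)" by (simp add: \<epsilon>_def \<tau>_def eval_nat_numeral)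
    finally have "trunc_sum G \<tau> U V \<le> \<tau> * (card A + \<eta> * N)"
      using trunc_sum_le[OF fin, of \<tau> G] \<tau> bad by (simp add: algebra_simps \<epsilon>_def)
    then have "\<tau> * card H \<le> \<tau> * (card A + \<eta> * N)"
      "\<tau> * (real (card U) + card V - card H - \<eta> * N) \<le> \<tau> * (card A + \<eta> * N)"
      using H by auto
    then have le: "card H \<le> card A + \<eta> * N" "real (card U) + card V - card H - \<eta> * N \<le> card A + \<eta> * N"
      using \<tau> by auto
    have "\<eta> * N \<le> \<eta> * (2 * card A)" using N2 \<eta> by (intro mult_left_mono) auto
    moreover have "0 \<le> 4 * \<eta> * card H" using \<eta> by simp
    ultimately show ?thesis using H le by (intro exI[of _ H]) (auto simp: algebra_simps)
  qed
qed

end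

section \<open>Containers\<close>

lemma card_small_subsets_le:
  assumes "finite A" "card A \<le> n"
  shows "finite {S. S \<subseteq> A \<and> card S \<le> b}" "card {S. S \<subseteq> A \<and> card S \<le> b} \<le> (n + 1) ^ b"
proof -
  show "finite {S. S \<subseteq> A \<and> card S \<le> b}" using assms by simp
  have "{S. S \<subseteq> A \<and> card S \<le> b} = (\<Union>i\<le>b. {S. S \<subseteq> A \<and> card S = i})" by auto
  then have "card {S. S \<subseteq> A \<and> card S \<le> b} \<le> (\<Sum>i\<le>b. card {S. S \<subseteq> A \<and> card S = i})"
    using card_UN_le[of "{..b}"] by simp
  also have "\<dots> = (\<Sum>i\<le>b. card A choose i)" using assms by (simp add: n_subsets)
  also have "\<dots> \<le> (\<Sum>i\<le>b. (b choose i) * n ^ i)"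
  proof (rule sum_mono)
    fix i assume "i \<in> {..b}"
    then have "1 \<le> b choose i" by (simp add: Suc_leI)
    moreover have "card A choose i \<le> n ^ i"
      using assms
      by (metis binomial_eq_0 binomial_le_pow le0 le_trans not_le power_mono)
    ultimately show "card A choose i \<le> (b choose i) * n ^ i"
      using mult_le_mono[of 1 "b choose i" "card A choose i" "n ^ i"] by simp
  qed
  also have "\<dots> = (n + 1) ^ b" unfolding binomial_ring by simp
  finally show "card {S. S \<subseteq> A \<and> card S \<le> b} \<le> (n + 1) ^ b" .
qed

text \<open>The pairs compatible with a state: \<open>A1\<close> and \<open>A2\<close> are the
  places left for \<open>X1\<close> and \<open>X2\<close>, and \<open>A\<close> consists of products
  already known to occur. The state \<open>(F1, F2, {})\<close> gives all pairs to be
  counted.\<close>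

definition sumset_pairs ::
    "('a, 'b) monoid_scheme \<Rightarrow> nat \<Rightarrow> nat \<Rightarrow> nat \<Rightarrow> 'a set \<Rightarrow> 'a set \<Rightarrow> 'a set \<Rightarrow> ('a set \<times> 'a set) set" where
  "sumset_pairs G s1 s2 m A1 A2 A =
     {(X1, X2). X1 \<subseteq> A1 \<and> X2 \<subseteq> A2 \<and> card X1 = s1 \<and> card X2 = s2 \<and>
                A \<subseteq> X1 <#>\<^bsub>G\<^esub> X2 \<and> card (X1 <#>\<^bsub>G\<^esub> X2) \<le> m}"

context comm_group
begin

text \<open>Averaging: the \<open>x\<close> with fewer than \<open>\<epsilon> / 2 * card A2\<close>
  bad partners account for at most half of the assumed bad pairs, and each remaining
  \<open>x\<close> has at most \<open>card A2\<close> bad partners.\<close>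

lemma card_good_ge:
  fixes \<epsilon> :: real
  assumes "finite A1" "finite A2" "A2 \<noteq> {}" "0 < \<epsilon>"
    and bad: "\<epsilon> * (card A1 * card A2) < card {p \<in> A1 \<times> A2. fst p \<otimes> snd p \<notin> A}"
  shows "\<epsilon> / 2 * card A1 \<le> card {x \<in> A1. \<epsilon> / 2 * card A2 \<le> card {y \<in> A2. x \<otimes> y \<notin> A}}"
proof -
  define d where "d x = real (card {y \<in> A2. x \<otimes> y \<notin> A})" for x
  let ?g = "{x \<in> A1. \<epsilon> / 2 * card A2 \<le> d x}"
  have "{p \<in> A1 \<times> A2. fst p \<otimes> snd p \<notin> A} = (SIGMA x:A1. {y \<in> A2. x \<otimes> y \<notin> A})" by auto
  then have "card {p \<in> A1 \<times> A2. fst p \<otimes> snd p \<notin> A} = (\<Sum>x\<in>A1. d x)"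
    using assms by (simp add: d_def card_SigmaI)
  also have "\<dots> \<le> (\<Sum>x\<in>A1. (if \<epsilon> / 2 * card A2 \<le> d x then real (card A2) else 0) + \<epsilon> / 2 * card A2)"
  proof (rule sum_mono)
    fix x
    have "card {y \<in> A2. x \<otimes> y \<notin> A} \<le> card A2" using assms by (intro card_mono) auto
    then have "d x \<le> card A2" by (simp add: d_def)
    moreover have "0 \<le> \<epsilon> / 2 * card A2" using assms by simp
    ultimately show "d x \<le> (if \<epsilon> / 2 * card A2 \<le> d x then real (card A2) else 0) + \<epsilon> / 2 * card A2"
      by auto
  qed
  also have "\<dots> = real (card ?g) * card A2 + \<epsilon> / 2 * card A2 * card A1"
    using assms by (simp add: sum.distrib sum.If_cases Int_def)
  finally have "\<epsilon> * (card A1 * card A2) < real (card ?g) * card A2 + \<epsilon> / 2 * card A2 * card A1"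
    using bad by simp
  then have "(\<epsilon> / 2 * card A1) * card A2 < real (card ?g) * card A2" by (simp add: algebra_simps)
  then have "\<epsilon> / 2 * card A1 < card ?g" by (rule mult_right_less_imp_less) simp
  then show ?thesis by (simp add: d_def)
qed

text \<open>Count the pairs \<open>(t, y)\<close> with \<open>t y\<close> outside \<open>A\<close>;
  there are at least \<open>b * \<epsilon> / 2 * card A2\<close>. Those with \<open>y\<close> in the
  shrunk set are few: at most \<open>\<epsilon> * b / 4\<close> per \<open>y\<close> stay outside
  \<open>A \<union> T1 T2\<close>, and each \<open>t\<close> has at most \<open>b\<^sup>2\<close>
  partners with product in \<open>T1 T2\<close>. The remaining pairs use a \<open>y\<close> that has
  been removed, which carries at most \<open>b\<close> pairs.\<close>

lemma card_shrunk_le: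
  fixes \<epsilon> :: real
  assumes fin: "finite A2" "finite T1" "finite T2" and sub: "A2 \<subseteq> carrier G" "T1 \<subseteq> carrier G"
    and \<epsilon>: "0 < \<epsilon>" and b: "0 < b" "card T1 = b" "card T2 \<le> b" "8 * real b ^ 2 \<le> \<epsilon> * card A2"
    and good: "\<And>t. t \<in> T1 \<Longrightarrow> \<epsilon> / 2 * card A2 \<le> card {y \<in> A2. t \<otimes> y \<notin> A}"
  shows "card {y \<in> A2. card {t \<in> T1. t \<otimes> y \<notin> A \<union> (T1 <#> T2)} < \<epsilon> * b / 4}
    \<le> (1 - \<epsilon> / 8) * card A2"
proof -
  let ?C = "A \<union> (T1 <#> T2)"
  let ?B = "{y \<in> A2. card {t \<in> T1. t \<otimes> y \<notin> ?C} < \<epsilon> * b / 4}"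
  let ?W = "SIGMA t:T1. {y \<in> A2. t \<otimes> y \<notin> A}"
  let ?W2 = "SIGMA y:?B. {t \<in> T1. t \<otimes> y \<notin> ?C}"
  let ?W3 = "SIGMA t:T1. {y \<in> A2. t \<otimes> y \<in> T1 <#> T2}"
  have w: "b * (\<epsilon> / 2 * card A2) \<le> card ?W"
  proof -
    have "real b * (\<epsilon> / 2 * card A2) = (\<Sum>t\<in>T1. \<epsilon> / 2 * card A2)" using b by simp
    also have "\<dots> \<le> (\<Sum>t\<in>T1. real (card {y \<in> A2. t \<otimes> y \<notin> A}))" by (intro sum_mono good)
    also have "\<dots> = card ?W" using fin by (simp add: card_SigmaI)
    finally show ?thesis .
  qed
  have finB: "finite ?B" using fin by simp
  have w2: "card ?W2 \<le> card A2 * (\<epsilon> * b / 4)"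
  proof -
    have "real (card ?W2) = (\<Sum>y\<in>?B. real (card {t \<in> T1. t \<otimes> y \<notin> ?C}))"
      using fin finB by (simp add: card_SigmaI)
    also have "\<dots> \<le> (\<Sum>y\<in>?B. \<epsilon> * b / 4)" by (intro sum_mono) auto
    also have "\<dots> \<le> card A2 * (\<epsilon> * b / 4)"
      using fin \<epsilon> card_mono[of A2 ?B] by (simp add: mult_right_mono)
    finally show ?thesis .
  qed
  have w3: "real (card ?W3) \<le> b * (real b ^ 2)"
  proof -
    have "card {y \<in> A2. t \<otimes> y \<in> T1 <#> T2} \<le> b * b" if t: "t \<in> T1" for t
    proof -
      have "card {y \<in> A2. t \<otimes> y \<in> T1 <#> T2} \<le> card (T1 <#> T2)"
      proof (rule card_inj_on_le[of "(\<otimes>) t"])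
        show "inj_on ((\<otimes>) t) {y \<in> A2. t \<otimes> y \<in> T1 <#> T2}"
          using t sub by (auto simp: inj_on_def subset_iff)
      qed (use fin finite_set_mult in auto)
      also have "\<dots> \<le> card T1 * card T2" using fin by (intro card_set_mult_le)
      also have "\<dots> \<le> b * b" using b by (intro mult_le_mono) auto
      finally show ?thesis .
    qed
    then have "(\<Sum>t\<in>T1. card {y \<in> A2. t \<otimes> y \<in> T1 <#> T2}) \<le> (\<Sum>t\<in>T1. b * b)"
      by (intro sum_mono)
    then have "card ?W3 \<le> b * (b * b)" using fin b by (simp add: card_SigmaI)
    then have "real (card ?W3) \<le> real (b * (b * b))" using of_nat_le_iff by blast
    then show ?thesis by (simp add: power2_eq_square)
  qed
  have "card ?W \<le> card (T1 \<times> (A2 - ?B) \<union> (\<lambda>(y, t). (t, y)) ` ?W2 \<union> ?W3)"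
    using fin finB by (intro card_mono) (auto simp: image_iff)
  also have "\<dots> \<le> card (T1 \<times> (A2 - ?B)) + card ((\<lambda>(y, t). (t, y)) ` ?W2) + card ?W3"
    by (meson add_le_mono card_Un_le le_refl order_trans)
  also have "card ((\<lambda>(y, t). (t, y)) ` ?W2) \<le> card ?W2" using fin finB by (intro card_image_le) simp
  also have "card (T1 \<times> (A2 - ?B)) = b * card (A2 - ?B)" using b by (simp add: card_cartesian_product)
  finally have "card ?W \<le> b * card (A2 - ?B) + card ?W2 + card ?W3" by linarith
  then have "real (card ?W) \<le> real (b * card (A2 - ?B) + card ?W2 + card ?W3)"
    by (rule of_nat_mono)
  then have "real b * (\<epsilon> / 2 * card A2) \<le> b * (real (card (A2 - ?B)) + card A2 * \<epsilon> / 4 + real b ^ 2)"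
    using w w2 w3 by (simp add: algebra_simps)
  then have "\<epsilon> / 2 * card A2 \<le> real (card (A2 - ?B)) + card A2 * \<epsilon> / 4 + real b ^ 2"
    using b by simp
  then have "\<epsilon> / 8 * card A2 \<le> real (card (A2 - ?B))" using b by simp
  moreover have "real (card (A2 - ?B)) = real (card A2) - card ?B"
    using fin finB card_mono[of A2 ?B] by (subst card_Diff_subset) auto
  ultimately show ?thesis by (simp add: algebra_simps)
qed

text \<open>A greedy choice, made at once by taking \<open>T2\<close> of maximal size among the sets
  whose elements contribute at least \<open>c\<close> new products on average. If it has fewer than
  \<open>b\<close> elements, a \<open>y\<close> with \<open>c\<close> further new products would
  contradict maximality.\<close>

lemma obtain_saturated:
  fixes c :: real
  assumes fin: "finite A" "finite T1" "finite X" and sub: "X \<subseteq> carrier G" "T1 \<subseteq> carrier G"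
    and "0 < c"
  obtains T2 where "T2 \<subseteq> X" "card T2 \<le> b"
    "real (card A) + card T2 * c \<le> card (A \<union> (T1 <#> T2))"
    "card T2 = b \<or> (\<forall>y\<in>X. card {t \<in> T1. t \<otimes> y \<notin> A \<union> (T1 <#> T2)} < c)"
proof -
  let ?P = "\<lambda>T. T \<subseteq> X \<and> card T \<le> b \<and> real (card A) + card T * c \<le> card (A \<union> (T1 <#> T))"
  have "?P {}" by (simp add: set_mult_def)
  moreover have "\<forall>T. ?P T \<longrightarrow> card T < Suc b" by auto
  ultimately obtain T2 where T2: "?P T2" and max: "\<And>T. ?P T \<Longrightarrow> card T \<le> card T2"
    using ex_has_greatest_nat[of ?P "{}" card "Suc b"] by (metis (no_types, lifting))
  let ?C = "A \<union> (T1 <#> T2)"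
  have finT2: "finite T2" using T2 fin finite_subset by blast
  have "card {t \<in> T1. t \<otimes> y \<notin> ?C} < c" if y: "y \<in> X" and b: "card T2 \<noteq> b" for y
  proof (rule ccontr)
    assume "\<not> card {t \<in> T1. t \<otimes> y \<notin> ?C} < c"
    then have c: "c \<le> card {t \<in> T1. t \<otimes> y \<notin> ?C}" by simp
    let ?N = "(\<lambda>t. t \<otimes> y) ` {t \<in> T1. t \<otimes> y \<notin> ?C}"
    have "inj_on (\<lambda>t. t \<otimes> y) {t \<in> T1. t \<otimes> y \<notin> ?C}"
      using sub y by (auto simp: inj_on_def subset_iff)
    then have cN: "card ?N = card {t \<in> T1. t \<otimes> y \<notin> ?C}" by (rule card_image)
    have finC: "finite ?C" using fin finT2 by (simp add: finite_set_mult)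
    have C': "?C \<union> ?N \<subseteq> A \<union> (T1 <#> insert y T2)" by (auto simp: set_mult_def)
    show False
    proof (cases "y \<in> T2")
      case True
      then have "?N = {}" by (auto simp: set_mult_def)
      then have "card ?N = 0" by (rule ssubst) (rule card.empty)
      then show False using c cN \<open>0 < c\<close> by linarith
    next
      case False
      have "card ?C + card ?N = card (?C \<union> ?N)"
        using finC fin by (intro card_Un_disjoint[symmetric]) auto
      also have "\<dots> \<le> card (A \<union> (T1 <#> insert y T2))"
        using C' fin finT2 by (intro card_mono) (auto simp: finite_set_mult)
      finally have "real (card ?C) + card ?N \<le> card (A \<union> (T1 <#> insert y T2))" by linarith
      then have "?P (insert y T2)"
        using T2 y b c cN False finT2 by (simp add: algebra_simps)
      then have "card (insert y T2) \<le> card T2" by (rule max)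
      then show False using False finT2 by simp
    qed
  qed
  then show ?thesis using that T2 by blast
qed

text \<open>
  The elements of \<open>good\<close> have many products outside \<open>A\<close>. If \<open>X\<^sub>1\<close> contains few of them, they are
  listed (\<open>S1\<close>) and the rest of \<open>good\<close> is discarded. Otherwise some \<open>T\<^sub>1 \<subseteq> X\<^sub>1 \<inter> good\<close> of size \<open>b\<close> is
  combined with a greedily chosen \<open>T\<^sub>2 \<subseteq> X\<^sub>2\<close>: if the choice does not stop early, \<open>A\<close> grows by
  \<open>T\<^sub>1T\<^sub>2\<close> (\<open>S2\<close>); if it does, all of \<open>X\<^sub>2\<close> lies in \<open>shrink T1 T2\<close> (\<open>S3\<close>).
\<close>

lemma container_step:
  fixes \<epsilon> :: real and n b :: nat
  assumes fin: "finite A1" "finite A2" "finite A" and sub: "A1 \<subseteq> carrier G" "A2 \<subseteq> carrier G"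
    and \<epsilon>: "0 < \<epsilon>"
    and bad: "\<epsilon> * (card A1 * card A2) < card {p \<in> A1 \<times> A2. fst p \<otimes> snd p \<notin> A}"
    and n: "card A1 \<le> n" "card A2 \<le> n"
    and b: "0 < b" "4 * real b \<le> \<epsilon> * card A1" "8 * real b ^ 2 \<le> \<epsilon> * card A2"
  obtains \<S> where "finite \<S>" "card \<S> \<le> 3 * (n + 1) ^ (2 * b)"
    "sumset_pairs G s1 s2 m A1 A2 A \<subseteq> (\<Union>(B1, B2, C)\<in>\<S>. sumset_pairs G s1 s2 m B1 B2 C)"
    "\<And>B1 B2 C. (B1, B2, C) \<in> \<S> \<Longrightarrow> B1 \<subseteq> A1 \<and> B2 \<subseteq> A2 \<and> A \<subseteq> C \<and> finite C \<and>
       (card B1 \<le> (1 - \<epsilon> / 8) * card A1 \<or> card B2 \<le> (1 - \<epsilon> / 8) * card A2 \<or>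
        card A + \<epsilon> * real b ^ 2 / 4 \<le> card C)"
proof -
  have c2: "0 < real (card A2)"
  proof (rule ccontr)
    assume "\<not> 0 < real (card A2)"
    then show False using b by simp
  qed
  define good where "good = {x \<in> A1. \<epsilon> / 2 * card A2 \<le> card {y \<in> A2. x \<otimes> y \<notin> A}}"
  have cgood: "\<epsilon> / 2 * card A1 \<le> card good"
    unfolding good_def using fin \<epsilon> bad c2 by (intro card_good_ge) auto
  have good: "good \<subseteq> A1" "finite good" using fin by (auto simp: good_def)
  define small where "small F = {S :: 'a set. S \<subseteq> F \<and> card S \<le> b}" for F
  have sm: "finite (small A1)" "card (small A1) \<le> (n + 1) ^ b" "finite (small A2)" "card (small A2) \<le> (n + 1) ^ b"
    unfolding small_def using card_small_subsets_le fin n by blast+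
  define TT where "TT = {(T1, T2) \<in> small A1 \<times> small A2. T1 \<subseteq> good \<and> card T1 = b}"
  have TT: "TT \<subseteq> small A1 \<times> small A2" by (auto simp: TT_def)
  have finTT: "finite TT" using TT sm finite_subset by blast
  have "card TT \<le> card (small A1 \<times> small A2)" using TT sm by (intro card_mono) auto
  also have "\<dots> \<le> (n + 1) ^ b * (n + 1) ^ b"
    using sm by (simp add: card_cartesian_product mult_le_mono)
  finally have cTT: "card TT \<le> (n + 1) ^ (2 * b)" by (simp add: power_add mult_2)
  define S1 where "S1 = (\<lambda>S. ((A1 - good) \<union> S, A2, A)) ` {S \<in> small A1. S \<subseteq> good}"
  define S2 where "S2 = (\<lambda>(T1, T2). (A1, A2, A \<union> (T1 <#> T2))) `
     {p \<in> TT. card A + \<epsilon> * real b ^ 2 / 4 \<le> card (A \<union> (fst p <#> snd p))}"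
  define shrink where "shrink T1 T2 = {y \<in> A2. card {t \<in> T1. t \<otimes> y \<notin> A \<union> (T1 <#> T2)} < \<epsilon> * b / 4}" for T1 T2
  define S3 where "S3 = (\<lambda>(T1, T2). (A1, shrink T1 T2, A \<union> (T1 <#> T2))) ` TT"
  have finS: "finite S1" "finite S2" "finite S3"
    unfolding S1_def S2_def S3_def using sm finTT by auto
  have "card S1 \<le> card {S \<in> small A1. S \<subseteq> good}" unfolding S1_def using sm by (intro card_image_le) simp
  also have "\<dots> \<le> card (small A1)" using sm by (intro card_mono) auto
  also have "\<dots> \<le> (n + 1) ^ (2 * b)"
    using sm power_increasing[of b "2 * b" "n + 1"] by simp
  finally have cS1: "card S1 \<le> (n + 1) ^ (2 * b)" .
  have "card S2 \<le> card {p \<in> TT. card A + \<epsilon> * real b ^ 2 / 4 \<le> card (A \<union> (fst p <#> snd p))}"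
    unfolding S2_def using finTT by (intro card_image_le) simp
  also have "\<dots> \<le> card TT" using finTT by (intro card_mono) auto
  finally have cS2: "card S2 \<le> (n + 1) ^ (2 * b)" using cTT by simp
  have cS3: "card S3 \<le> (n + 1) ^ (2 * b)"
    unfolding S3_def using finTT cTT card_image_le order_trans by blast
  have TTD: "T1 \<subseteq> good" "card T1 = b" "T2 \<subseteq> A2" "card T2 \<le> b" "finite T1" "finite T2"
    if "(T1, T2) \<in> TT" for T1 T2
    using that fin good finite_subset by (auto simp: TT_def small_def)
  show ?thesis
  proof (rule that[of "S1 \<union> S2 \<union> S3"])
    show "finite (S1 \<union> S2 \<union> S3)" using finS by simp
    show "card (S1 \<union> S2 \<union> S3) \<le> 3 * (n + 1) ^ (2 * b)"
      using cS1 cS2 cS3 card_Un_le[of "S1 \<union> S2" S3] card_Un_le[of S1 S2] by linarith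
    show "B1 \<subseteq> A1 \<and> B2 \<subseteq> A2 \<and> A \<subseteq> C \<and> finite C \<and>
       (card B1 \<le> (1 - \<epsilon> / 8) * card A1 \<or> card B2 \<le> (1 - \<epsilon> / 8) * card A2 \<or>
        card A + \<epsilon> * real b ^ 2 / 4 \<le> card C)" if mem: "(B1, B2, C) \<in> S1 \<union> S2 \<union> S3" for B1 B2 C
    proof -
      consider (1) "(B1, B2, C) \<in> S1" | (2) "(B1, B2, C) \<in> S2" | (3) "(B1, B2, C) \<in> S3"
        using mem by blast
      then show ?thesis
      proof cases
        case 1
        then obtain S where S: "S \<subseteq> good" "card S \<le> b" "B1 = (A1 - good) \<union> S" "B2 = A2" "C = A"
          by (auto simp: S1_def small_def)
        \<comment> \<open>At least \<open>\<epsilon> / 2 * card A1\<close> elements are discarded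
          and at most \<open>b \<le> \<epsilon> / 4 * card A1\<close> of them are put back.\<close>
        have "card B1 \<le> card (A1 - good) + card S" using S card_Un_le by simp
        also have "\<dots> \<le> card A1 - card good + b" using good fin S by (simp add: card_Diff_subset)
        finally have "real (card B1) \<le> real (card A1) - card good + b"
          using card_mono[OF fin(1) good(1)] by linarith
        also have "\<dots> \<le> real (card A1) - \<epsilon> / 4 * card A1" using cgood b by simp
        also have "\<dots> \<le> (1 - \<epsilon> / 8) * card A1" using \<epsilon> by (simp add: algebra_simps)
        finally show ?thesis using S good fin by auto
      next
        case 2
        then obtain T1 T2 where T: "(T1, T2) \<in> TT" "B1 = A1" "B2 = A2" "C = A \<union> (T1 <#> T2)"
          "card A + \<epsilon> * real b ^ 2 / 4 \<le> card (A \<union> (T1 <#> T2))"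
          by (auto simp: S2_def)
        then show ?thesis using TTD[OF T(1)] fin finite_set_mult[of T1 T2 G] by auto
      next
        case 3
        then obtain T1 T2 where T: "(T1, T2) \<in> TT" "B1 = A1" "B2 = shrink T1 T2" "C = A \<union> (T1 <#> T2)"
          by (auto simp: S3_def)
        note D = TTD[OF T(1)]
        have "card B2 \<le> (1 - \<epsilon> / 8) * card A2"
          unfolding T(3) shrink_def
        proof (rule card_shrunk_le)
          show "\<epsilon> / 2 * card A2 \<le> card {y \<in> A2. t \<otimes> y \<notin> A}" if "t \<in> T1" for t
            using that D by (auto simp: good_def)
          show "T1 \<subseteq> carrier G" using D good sub by blast
        qed (use fin sub \<epsilon> b D in auto)
        moreover have "B2 \<subseteq> A2" unfolding T(3) shrink_def by blast
        ultimately show ?thesis using T D fin finite_set_mult[of T1 T2 G] by auto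
      qed
    qed
    show "sumset_pairs G s1 s2 m A1 A2 A \<subseteq> (\<Union>(B1, B2, C)\<in>S1 \<union> S2 \<union> S3. sumset_pairs G s1 s2 m B1 B2 C)"
    proof clarify
      fix X1 X2 assume X: "(X1, X2) \<in> sumset_pairs G s1 s2 m A1 A2 A"
      have sX: "X1 \<subseteq> A1" "X2 \<subseteq> A2" "A \<subseteq> X1 <#> X2" using X by (auto simp: sumset_pairs_def)
      have finX: "finite X1" "finite X2"
        using finite_subset[OF sX(1) fin(1)] finite_subset[OF sX(2) fin(2)] by simp_all
      have "\<exists>B1 B2 C. (B1, B2, C) \<in> S1 \<union> S2 \<union> S3 \<and> X1 \<subseteq> B1 \<and> X2 \<subseteq> B2 \<and> C \<subseteq> X1 <#> X2"
      proof (cases "card (X1 \<inter> good) \<le> b")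
        case True
        have "((A1 - good) \<union> (X1 \<inter> good), A2, A) \<in> S1"
          using True sX by (auto simp: S1_def small_def)
        moreover have "X1 \<subseteq> (A1 - good) \<union> (X1 \<inter> good)" using sX by blast
        ultimately show ?thesis using sX by blast
      next
        case False
        then obtain T1 where T1: "T1 \<subseteq> X1 \<inter> good" "card T1 = b"
          by (meson nat_le_linear obtain_subset_with_card_n)
        have T1': "finite T1" "T1 \<subseteq> carrier G" using T1 finX finite_subset good sub by blast+
        have "X2 \<subseteq> carrier G" "0 < \<epsilon> * b / 4" using sX sub \<epsilon> b by auto
        then obtain T2 where T2: "T2 \<subseteq> X2" "card T2 \<le> b"
          "real (card A) + card T2 * (\<epsilon> * b / 4) \<le> card (A \<union> (T1 <#> T2))"
          "card T2 = b \<or> (\<forall>y\<in>X2. card {t \<in> T1. t \<otimes> y \<notin> A \<union> (T1 <#> T2)} < \<epsilon> * b / 4)"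
          by (rule obtain_saturated[OF fin(3) T1'(1) finX(2) _ T1'(2)])
        have mem: "(T1, T2) \<in> TT" using T1 T2 sX by (auto simp: TT_def small_def)
        have "T1 <#> T2 \<subseteq> X1 <#> X2"
          unfolding set_mult_eq_image using T1 T2 by (intro image_mono) auto
        then have C: "A \<union> (T1 <#> T2) \<subseteq> X1 <#> X2" using sX by blast
        from T2(4) show ?thesis
        proof
          assume "card T2 = b"
          then have "card A + \<epsilon> * real b ^ 2 / 4 \<le> card (A \<union> (T1 <#> T2))"
            using T2(3) by (simp add: power2_eq_square mult_ac)
          then have "(A1, A2, A \<union> (T1 <#> T2)) \<in> S2"
            using mem by (auto simp: S2_def intro!: rev_image_eqI[of "(T1, T2)"])
          then show ?thesis using sX C by blast
        next
          assume "\<forall>y\<in>X2. card {t \<in> T1. t \<otimes> y \<notin> A \<union> (T1 <#> T2)} < \<epsilon> * b / 4"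
          then have "X2 \<subseteq> shrink T1 T2" using sX by (auto simp: shrink_def)
          moreover have "(A1, shrink T1 T2, A \<union> (T1 <#> T2)) \<in> S3"
            using mem by (auto simp: S3_def intro!: rev_image_eqI[of "(T1, T2)"])
          ultimately show ?thesis using sX C by blast
        qed
      qed
      then obtain B1 B2 C where B: "(B1, B2, C) \<in> S1 \<union> S2 \<union> S3"
        "X1 \<subseteq> B1" "X2 \<subseteq> B2" "C \<subseteq> X1 <#> X2" by blast
      then have "(X1, X2) \<in> sumset_pairs G s1 s2 m B1 B2 C" using X by (simp add: sumset_pairs_def)
      then show "(X1, X2) \<in> (\<Union>(B1, B2, C)\<in>S1 \<union> S2 \<union> S3. sumset_pairs G s1 s2 m B1 B2 C)"
        using B(1) by blast
    qed
  qed
qed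

section \<open>Symmetry in the two factors\<close>

lemma set_mult_commute:
  assumes "U \<subseteq> carrier G" "V \<subseteq> carrier G"
  shows "U <#> V = V <#> U"
proof -
  have "U <#> V \<subseteq> V <#> U" if UV: "U \<subseteq> carrier G" "V \<subseteq> carrier G" for U V
  proof
    fix x assume "x \<in> U <#> V"
    then obtain u v where uv: "u \<in> U" "v \<in> V" "x = u \<otimes> v" by (auto simp: set_mult_def)
    then have "x = v \<otimes> u" using UV m_comm by blast
    then show "x \<in> V <#> U" using uv by (auto simp: set_mult_def)
  qed
  then show ?thesis using assms by blast
qed

lemma card_bad_pairs_swap:
  assumes "U \<subseteq> carrier G" "V \<subseteq> carrier G"
  shows "card {p \<in> V \<times> U. fst p \<otimes> snd p \<notin> A} = card {p \<in> U \<times> V. fst p \<otimes> snd p \<notin> A}"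
proof (rule bij_betw_same_card[of prod.swap], rule bij_betw_byWitness[of _ prod.swap])
  have c: "u \<otimes> v = v \<otimes> u" if "u \<in> U" "v \<in> V" for u v using that assms m_comm by blast
  show "prod.swap ` {p \<in> V \<times> U. fst p \<otimes> snd p \<notin> A} \<subseteq> {p \<in> U \<times> V. fst p \<otimes> snd p \<notin> A}"
    by (auto simp: c)
  show "prod.swap ` {p \<in> U \<times> V. fst p \<otimes> snd p \<notin> A} \<subseteq> {p \<in> V \<times> U. fst p \<otimes> snd p \<notin> A}"
    by (auto simp: c)
qed auto

lemma robust_kneser_symmetric:
  fixes \<eta> :: real
  assumes fin: "finite U" "finite V" "finite A" and sub: "U \<subseteq> carrier G" "V \<subseteq> carrier G"
    and \<eta>: "0 < \<eta>" "\<eta> \<le> 1" and ne: "U \<noteq> {}" "V \<noteq> {}"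
    and bad: "card {p \<in> U \<times> V. fst p \<otimes> snd p \<notin> A} \<le> \<eta> ^ 5 / 2048 * (card U * card V)"
  shows "\<exists>H. subgroup H G \<and> finite H \<and> card H \<le> (1 + 2 * \<eta>) * card A \<and>
     real (card U) + card V \<le> (1 + 4 * \<eta>) * (real (card A) + card H)"
proof (cases "card V \<le> card U")
  case True
  show ?thesis by (rule robust_kneser[OF fin sub \<eta> ne(2) True bad])
next
  case False
  have "card {p \<in> V \<times> U. fst p \<otimes> snd p \<notin> A} \<le> \<eta> ^ 5 / 2048 * (card V * card U)"
    using bad card_bad_pairs_swap[OF sub] by (simp add: mult.commute)
  from robust_kneser[OF fin(2,1,3) sub(2,1) \<eta> ne(1) _ this] False show ?thesis
    by (simp add: add.commute)
qed

lemma sumset_pairs_swap: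
  assumes "A1 \<subseteq> carrier G" "A2 \<subseteq> carrier G"
  shows "(X1, X2) \<in> sumset_pairs G s1 s2 m A1 A2 A \<longleftrightarrow> (X2, X1) \<in> sumset_pairs G s2 s1 m A2 A1 A"
proof -
  have "X1 <#> X2 = X2 <#> X1" if "X1 \<subseteq> A1" "X2 \<subseteq> A2"
    using that assms by (intro set_mult_commute) auto
  then show ?thesis by (auto simp: sumset_pairs_def)
qed

text \<open>The single step needs \<open>8 * b\<^sup>2 \<le> \<epsilon> * card A2\<close>. The
  larger of the two sets has at least \<open>m / 2\<close> elements, so it satisfies this; by
  commutativity it may be put in second place.\<close>

lemma container_step_symmetric:
  fixes \<epsilon> :: real and n b :: nat
  assumes fin: "finite A1" "finite A2" "finite A" and sub: "A1 \<subseteq> carrier G" "A2 \<subseteq> carrier G"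
    and \<epsilon>: "0 < \<epsilon>"
    and bad: "\<epsilon> * (card A1 * card A2) < card {p \<in> A1 \<times> A2. fst p \<otimes> snd p \<notin> A}"
    and n: "card A1 \<le> n" "card A2 \<le> n"
    and b: "0 < b" "4 * real b \<le> \<epsilon> * card A1" "4 * real b \<le> \<epsilon> * card A2"
      "16 * real b ^ 2 \<le> \<epsilon> * m" "m \<le> card A1 + card A2"
  obtains \<S> where "finite \<S>" "card \<S> \<le> 3 * (n + 1) ^ (2 * b)"
    "sumset_pairs G s1 s2 m A1 A2 A \<subseteq> (\<Union>(B1, B2, C)\<in>\<S>. sumset_pairs G s1 s2 m B1 B2 C)"
    "\<And>B1 B2 C. (B1, B2, C) \<in> \<S> \<Longrightarrow> B1 \<subseteq> A1 \<and> B2 \<subseteq> A2 \<and> A \<subseteq> C \<and> finite C \<and>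
       (card B1 \<le> (1 - \<epsilon> / 8) * card A1 \<or> card B2 \<le> (1 - \<epsilon> / 8) * card A2 \<or>
        card A + \<epsilon> * real b ^ 2 / 4 \<le> card C)"
proof (cases "card A1 \<le> card A2")
  case True
  then have "\<epsilon> * m \<le> \<epsilon> * (2 * card A2)" using b \<epsilon> by (intro mult_left_mono) auto
  then have "8 * real b ^ 2 \<le> \<epsilon> * card A2" using b by simp
  then show ?thesis using container_step[OF fin sub \<epsilon> bad n b(1,2)] that by blast
next
  case False
  then have "\<epsilon> * m \<le> \<epsilon> * (2 * card A1)" using b \<epsilon> by (intro mult_left_mono) auto
  then have b8: "8 * real b ^ 2 \<le> \<epsilon> * card A1" using b by simp
  have bad': "\<epsilon> * (card A2 * card A1) < card {p \<in> A2 \<times> A1. fst p \<otimes> snd p \<notin> A}"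
    using bad card_bad_pairs_swap[OF sub] by (simp add: mult.commute)
  obtain \<S> where S: "finite \<S>" "card \<S> \<le> 3 * (n + 1) ^ (2 * b)"
    and cover: "sumset_pairs G s2 s1 m A2 A1 A \<subseteq> (\<Union>(B1, B2, C)\<in>\<S>. sumset_pairs G s2 s1 m B1 B2 C)"
    and step: "\<And>B1 B2 C. (B1, B2, C) \<in> \<S> \<Longrightarrow> B1 \<subseteq> A2 \<and> B2 \<subseteq> A1 \<and> A \<subseteq> C \<and> finite C \<and>
       (card B1 \<le> (1 - \<epsilon> / 8) * card A2 \<or> card B2 \<le> (1 - \<epsilon> / 8) * card A1 \<or>
        card A + \<epsilon> * real b ^ 2 / 4 \<le> card C)"
    by (rule container_step[OF fin(2,1,3) sub(2,1) \<epsilon> bad' n(2,1) b(1,3) b8]) blast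
  let ?f = "\<lambda>(B1, B2, C). (B2, B1, C)"
  show ?thesis
  proof (rule that[of "?f ` \<S>"])
    show "finite (?f ` \<S>)" using S by simp
    show "card (?f ` \<S>) \<le> 3 * (n + 1) ^ (2 * b)" using S card_image_le[OF S(1)] order_trans by blast
    show "sumset_pairs G s1 s2 m A1 A2 A \<subseteq> (\<Union>(B1, B2, C)\<in>?f ` \<S>. sumset_pairs G s1 s2 m B1 B2 C)"
    proof clarify
      fix X1 X2 assume "(X1, X2) \<in> sumset_pairs G s1 s2 m A1 A2 A"
      then have "(X2, X1) \<in> sumset_pairs G s2 s1 m A2 A1 A" using sumset_pairs_swap sub by blast
      then obtain B1 B2 C where B: "(B1, B2, C) \<in> \<S>" "(X2, X1) \<in> sumset_pairs G s2 s1 m B1 B2 C"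
        using cover by blast
      have "B1 \<subseteq> carrier G" "B2 \<subseteq> carrier G" using step[OF B(1)] sub by auto
      then have "(X1, X2) \<in> sumset_pairs G s1 s2 m B2 B1 C" using B(2) sumset_pairs_swap by blast
      then show "(X1, X2) \<in> (\<Union>(B1, B2, C)\<in>?f ` \<S>. sumset_pairs G s1 s2 m B1 B2 C)"
        using B(1) by force
    qed
    fix B1 B2 C assume "(B1, B2, C) \<in> ?f ` \<S>"
    then have "(B2, B1, C) \<in> \<S>" by auto
    from step[OF this] show "B1 \<subseteq> A1 \<and> B2 \<subseteq> A2 \<and> A \<subseteq> C \<and> finite C \<and>
       (card B1 \<le> (1 - \<epsilon> / 8) * card A1 \<or> card B2 \<le> (1 - \<epsilon> / 8) * card A2 \<or>
        card A + \<epsilon> * real b ^ 2 / 4 \<le> card C)" by blast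
  qed
qed

section \<open>Iterating the containers\<close>

lemma sumset_pairsD:
  assumes "(X1, X2) \<in> sumset_pairs G s1 s2 m A1 A2 A" "finite A1" "finite A2"
  shows "s1 \<le> card A1" "s2 \<le> card A2" "card A \<le> m"
proof -
  have X: "X1 \<subseteq> A1" "X2 \<subseteq> A2" "card X1 = s1" "card X2 = s2" "A \<subseteq> X1 <#> X2" "card (X1 <#> X2) \<le> m"
    using assms by (auto simp: sumset_pairs_def)
  have "finite X1" "finite X2"
    using finite_subset[OF X(1) assms(2)] finite_subset[OF X(2) assms(3)] by simp_all
  then have "card A \<le> card (X1 <#> X2)" using X by (intro card_mono finite_set_mult)
  then show "card A \<le> m" using X by simp
  show "s1 \<le> card A1" "s2 \<le> card A2" using X assms card_mono by metis+
qed

lemma card_sumset_pairs_le_choose: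
  assumes "finite A1" "finite A2"
  shows "finite (sumset_pairs G s1 s2 m A1 A2 A)"
    "card (sumset_pairs G s1 s2 m A1 A2 A) \<le> (card A1 choose s1) * (card A2 choose s2)"
proof -
  let ?R = "{X. X \<subseteq> A1 \<and> card X = s1} \<times> {X. X \<subseteq> A2 \<and> card X = s2}"
  have sub: "sumset_pairs G s1 s2 m A1 A2 A \<subseteq> ?R" by (auto simp: sumset_pairs_def)
  have fin: "finite ?R" using assms by simp
  show "finite (sumset_pairs G s1 s2 m A1 A2 A)" using sub fin finite_subset by blast
  show "card (sumset_pairs G s1 s2 m A1 A2 A) \<le> (card A1 choose s1) * (card A2 choose s2)"
    using card_mono[OF fin sub] assms by (simp add: card_cartesian_product n_subsets)
qed

text \<open>Induction on the depth \<open>k\<close> of a tree with branching at most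
  \<open>B\<close>. The left side of the last hypothesis is a potential: it is nonnegative for any
  state with a compatible pair, and it falls by at least 1 in every nonterminal step.
  \<open>Q\<close> bounds the pairs in a terminal state.\<close>

lemma card_sumset_pairs_le:
  fixes \<epsilon> Q B :: real and n b k :: nat
  defines "B \<equiv> real (3 * (n + 1) ^ (2 * b))"
  assumes \<epsilon>: "0 < \<epsilon>" "\<epsilon> \<le> 1" and s: "1 \<le> s1" "1 \<le> s2"
    and b: "0 < b" "4 * real b \<le> \<epsilon> * s1" "4 * real b \<le> \<epsilon> * s2" "16 * real b ^ 2 \<le> \<epsilon> * m"
    and Q: "0 \<le> Q"
    and terminal: "\<And>B1 B2 C. finite B1 \<Longrightarrow> finite B2 \<Longrightarrow> finite C \<Longrightarrow>
       B1 \<subseteq> carrier G \<Longrightarrow> B2 \<subseteq> carrier G \<Longrightarrow> B1 \<noteq> {} \<Longrightarrow> B2 \<noteq> {} \<Longrightarrow> card C \<le> m \<Longrightarrow>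
       card B1 + card B2 \<le> m \<or>
         card {p \<in> B1 \<times> B2. fst p \<otimes> snd p \<notin> C} \<le> \<epsilon> * (card B1 * card B2) \<Longrightarrow>
       real ((card B1 choose s1) * (card B2 choose s2)) \<le> Q"
    and A: "finite A1" "finite A2" "finite A" "A1 \<subseteq> carrier G" "A2 \<subseteq> carrier G" "card A1 \<le> n" "card A2 \<le> n"
    and k: "8 / \<epsilon> * (ln (card A1) + ln (card A2)) + (real m - card A) * (4 / (\<epsilon> * real b ^ 2)) < k"
  shows "card (sumset_pairs G s1 s2 m A1 A2 A) \<le> B ^ k * Q"
  using A k
proof (induction k arbitrary: A1 A2 A)
  case 0
  have "sumset_pairs G s1 s2 m A1 A2 A = {}"
  proof (rule ccontr)
    assume "sumset_pairs G s1 s2 m A1 A2 A \<noteq> {}"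
    then obtain X1 X2 where "(X1, X2) \<in> sumset_pairs G s1 s2 m A1 A2 A" by auto
    note D = sumset_pairsD[OF this "0.prems"(1,2)]
    have "0 \<le> 8 / \<epsilon> * (ln (card A1) + ln (card A2)) + (real m - card A) * (4 / (\<epsilon> * real b ^ 2))"
      using D s \<epsilon> by (intro add_nonneg_nonneg mult_nonneg_nonneg) (auto simp: Suc_le_eq)
    then show False using "0.prems" by simp
  qed
  then show ?case using Q by simp
next
  case (Suc k)
  let ?\<phi> = "\<lambda>A1 A2 A. 8 / \<epsilon> * (ln (card A1) + ln (card A2)) + (real m - card A) * (4 / (\<epsilon> * real b ^ 2))"
  have B1: "1 \<le> B" unfolding B_def using one_le_power[of "n + 1" "2 * b"] by linarith
  have nonneg: "0 \<le> B ^ k * Q" for k using Q B1 by simp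
  show ?case
  proof (cases "sumset_pairs G s1 s2 m A1 A2 A = {}")
    case True
    then show ?thesis using nonneg[of "Suc k"] nonneg[of k] by simp
  next
    case False
    then obtain X1 X2 where "(X1, X2) \<in> sumset_pairs G s1 s2 m A1 A2 A" by auto
    note D = sumset_pairsD[OF this Suc.prems(1,2)]
    have ne: "A1 \<noteq> {}" "A2 \<noteq> {}" using D s by auto
    show ?thesis
    proof (cases "card A1 + card A2 \<le> m \<or>
         card {p \<in> A1 \<times> A2. fst p \<otimes> snd p \<notin> A} \<le> \<epsilon> * (card A1 * card A2)")
      case True
      have "real (card (sumset_pairs G s1 s2 m A1 A2 A)) \<le> real ((card A1 choose s1) * (card A2 choose s2))"
        using card_sumset_pairs_le_choose(2)[OF Suc.prems(1,2)] by (rule of_nat_mono)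
      also have "\<dots> \<le> Q" by (rule terminal) (use Suc.prems ne D True in auto)
      also have "\<dots> \<le> B ^ Suc k * Q"
        using mult_right_mono[OF one_le_power[OF B1, of "Suc k"] Q] by simp
      finally show ?thesis .
    next
      case False
      then have bad: "\<epsilon> * (card A1 * card A2) < card {p \<in> A1 \<times> A2. fst p \<otimes> snd p \<notin> A}"
        and m: "m \<le> card A1 + card A2" by auto
      have "\<epsilon> * s1 \<le> \<epsilon> * card A1" "\<epsilon> * s2 \<le> \<epsilon> * card A2" using D \<epsilon> by auto
      then have b': "4 * real b \<le> \<epsilon> * card A1" "4 * real b \<le> \<epsilon> * card A2" using b by auto
      obtain \<S> where S: "finite \<S>" "card \<S> \<le> 3 * (n + 1) ^ (2 * b)"
        and cover: "sumset_pairs G s1 s2 m A1 A2 A \<subseteq> (\<Union>(B1, B2, C)\<in>\<S>. sumset_pairs G s1 s2 m B1 B2 C)"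
        and step: "\<And>B1 B2 C. (B1, B2, C) \<in> \<S> \<Longrightarrow> B1 \<subseteq> A1 \<and> B2 \<subseteq> A2 \<and> A \<subseteq> C \<and> finite C \<and>
           (card B1 \<le> (1 - \<epsilon> / 8) * card A1 \<or> card B2 \<le> (1 - \<epsilon> / 8) * card A2 \<or>
            card A + \<epsilon> * real b ^ 2 / 4 \<le> card C)"
        by (rule container_step_symmetric[OF Suc.prems(1-5) \<epsilon>(1) bad Suc.prems(6,7) b(1) b' b(4) m]) blast
      have each: "card (sumset_pairs G s1 s2 m B1 B2 C) \<le> B ^ k * Q" if mem: "(B1, B2, C) \<in> \<S>" for B1 B2 C
      proof (cases "sumset_pairs G s1 s2 m B1 B2 C = {}")
        case True
        then show ?thesis using nonneg[of "Suc k"] nonneg[of k] by simp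
      next
        case False
        note st = step[OF mem]
        have finB: "finite B1" "finite B2" using st Suc.prems finite_subset by auto
        obtain Y1 Y2 where "(Y1, Y2) \<in> sumset_pairs G s1 s2 m B1 B2 C" using False by auto
        note E = sumset_pairsD[OF this finB]
        have le: "card B1 \<le> card A1" "card B2 \<le> card A2" "card A \<le> card C"
          using st Suc.prems by (auto intro: card_mono)
        have pos: "0 < card B1" "0 < card B2" "0 < card A1" "0 < card A2" using E D s by auto
        have ln: "ln (card B1) \<le> ln (card A1)" "ln (card B2) \<le> ln (card A2)"
          using le pos by auto
        \<comment> \<open>The weight \<open>8 / \<epsilon>\<close> in the potential turns this loss
          into a decrease by 1; the weight \<open>4 / (\<epsilon> * b\<^sup>2)\<close> does the same
          for the growth of \<open>A\<close>.\<close>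
        have drop: "ln (real x) \<le> ln (real y) - \<epsilon> / 8"
          if "0 < x" "0 < y" "real x \<le> (1 - \<epsilon> / 8) * y" for x y :: nat
        proof -
          have "ln (real x) \<le> ln ((1 - \<epsilon> / 8) * y)" using that by simp
          also have "\<dots> = ln (1 - \<epsilon> / 8) + ln y" using that \<epsilon> by (intro ln_mult_pos) auto
          also have "ln (1 - \<epsilon> / 8) \<le> - (\<epsilon> / 8)" using ln_le_minus_one[of "1 - \<epsilon> / 8"] \<epsilon> by simp
          finally show ?thesis by simp
        qed
        have "?\<phi> B1 B2 C \<le> ?\<phi> A1 A2 A - 1"
        proof -
          have c0: "0 < 4 / (\<epsilon> * real b ^ 2)" using \<epsilon> b by simp
          have C: "(real m - card C) * (4 / (\<epsilon> * real b ^ 2)) \<le> (real m - card A) * (4 / (\<epsilon> * real b ^ 2))"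
            using le c0 by (intro mult_right_mono) auto
          have L: "8 / \<epsilon> * (ln (card B1) + ln (card B2)) \<le> 8 / \<epsilon> * (ln (card A1) + ln (card A2))"
            using ln \<epsilon> by (intro mult_left_mono) auto
          have L1: "8 / \<epsilon> * (ln (card B1) + ln (card B2)) \<le> 8 / \<epsilon> * (ln (card A1) + ln (card A2)) - 1"
            if "ln (card B1) + ln (card B2) \<le> ln (card A1) + ln (card A2) - \<epsilon> / 8"
          proof -
            have "8 / \<epsilon> * (ln (card B1) + ln (card B2)) \<le> 8 / \<epsilon> * (ln (card A1) + ln (card A2) - \<epsilon> / 8)"
              using that \<epsilon> by (intro mult_left_mono) auto
            also have "\<dots> = 8 / \<epsilon> * (ln (card A1) + ln (card A2)) - 1" using \<epsilon> by (simp add: field_simps)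
            finally show ?thesis .
          qed
          have C1: "(real m - card C) * (4 / (\<epsilon> * real b ^ 2)) \<le> (real m - card A) * (4 / (\<epsilon> * real b ^ 2)) - 1"
            if "card A + \<epsilon> * real b ^ 2 / 4 \<le> card C"
          proof -
            have "(real m - card C) * (4 / (\<epsilon> * real b ^ 2)) \<le> (real m - card A - \<epsilon> * real b ^ 2 / 4) * (4 / (\<epsilon> * real b ^ 2))"
              using that c0 by (intro mult_right_mono) auto
            also have "\<dots> = (real m - card A) * (4 / (\<epsilon> * real b ^ 2)) - 1"
              using \<epsilon> b by (simp add: field_simps)
            finally show ?thesis .
          qed
          from st consider "card B1 \<le> (1 - \<epsilon> / 8) * card A1" | "card B2 \<le> (1 - \<epsilon> / 8) * card A2"
            | "card A + \<epsilon> * real b ^ 2 / 4 \<le> card C" by blast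
          then show ?thesis
          proof cases
            case 1
            then show ?thesis using drop[OF pos(1,3)] ln L1 C by linarith
          next
            case 2
            then show ?thesis using drop[OF pos(2,4)] ln L1 C by linarith
          next
            case 3
            then show ?thesis using C1 L by linarith
          qed
        qed
        then have "?\<phi> B1 B2 C < k" using Suc.prems(8) by simp
        then show ?thesis using st finB Suc.prems le by (intro Suc.IH) auto
      qed
      have "card (sumset_pairs G s1 s2 m A1 A2 A) \<le> card (\<Union>(B1, B2, C)\<in>\<S>. sumset_pairs G s1 s2 m B1 B2 C)"
      proof (rule card_mono[OF _ cover])
        show "finite (\<Union>(B1, B2, C)\<in>\<S>. sumset_pairs G s1 s2 m B1 B2 C)"
        proof (intro finite_UN_I S(1), clarify)
          fix B1 B2 C assume "(B1, B2, C) \<in> \<S>"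
          from step[OF this] have "finite B1" "finite B2"
            using finite_subset[OF _ Suc.prems(1)] finite_subset[OF _ Suc.prems(2)] by simp_all
          then show "finite (sumset_pairs G s1 s2 m B1 B2 C)" by (rule card_sumset_pairs_le_choose(1))
        qed
      qed
      also have "\<dots> \<le> (\<Sum>(B1, B2, C)\<in>\<S>. card (sumset_pairs G s1 s2 m B1 B2 C))"
        using card_UN_le[OF S(1), of "\<lambda>(B1, B2, C). sumset_pairs G s1 s2 m B1 B2 C"]
        by (simp add: case_prod_unfold)
      finally have "real (card (sumset_pairs G s1 s2 m A1 A2 A))
         \<le> (\<Sum>(B1, B2, C)\<in>\<S>. real (card (sumset_pairs G s1 s2 m B1 B2 C)))"
        by (simp add: case_prod_unfold flip: of_nat_sum)
      also have "\<dots> \<le> (\<Sum>_\<in>\<S>. B ^ k * Q)" by (intro sum_mono) (use each in auto)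
      also have "\<dots> = card \<S> * (B ^ k * Q)" by simp
      also have "\<dots> \<le> B * (B ^ k * Q)"
        using of_nat_mono[OF S(2)] nonneg[of k] by (intro mult_right_mono) (simp_all add: B_def)
      finally show ?thesis by (simp add: mult.assoc)
    qed
  qed
qed

lemma card_le_subgroup_beta:
  assumes "subgroup H G" "finite H" "real (card H) \<le> t"
  shows "card H \<le> subgroup_beta G t"
proof -
  have "{card H | H. subgroup H G \<and> finite H \<and> real (card H) \<le> t} \<subseteq> {..nat \<lfloor>t\<rfloor>}"
    by (auto simp: le_nat_floor)
  then have "finite {card H | H. subgroup H G \<and> finite H \<and> real (card H) \<le> t}"
    using finite_subset by blast
  then show ?thesis unfolding subgroup_beta_def using assms by (intro Max_ge) auto
qed

text \<open>\<open>N\<close> bounds \<open>card B1 + card B2\<close> in every terminal state: either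
  this sum is at most \<open>m\<close>, or robust Kneser applies to \<open>C\<close> with
  \<open>card C \<le> m\<close> and the order of its subgroup is at most
  \<open>\<beta>\<close>.\<close>

lemma card_small_sumset_pairs_le:
  fixes \<eta> \<epsilon> :: real and n b k s1 s2 m N :: nat
  defines "\<epsilon> \<equiv> \<eta> ^ 5 / 2048"
  assumes \<eta>: "0 < \<eta>" "\<eta> \<le> 1" and s: "1 \<le> s1" "1 \<le> s2"
    and b: "0 < b" "4 * real b \<le> \<epsilon> * s1" "4 * real b \<le> \<epsilon> * s2" "16 * real b ^ 2 \<le> \<epsilon> * m"
    and F: "finite F1" "finite F2" "F1 \<subseteq> carrier G" "F2 \<subseteq> carrier G" "card F1 = n" "card F2 = n"
    and k: "16 / \<epsilon> * ln n + m * (4 / (\<epsilon> * real b ^ 2)) < k"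
    and N: "N = nat \<lfloor>(1 + 4 * \<eta>) * (m + real (subgroup_beta G ((1 + 2 * \<eta>) * m)))\<rfloor>"
  shows "card (small_sumset_pairs G F1 F2 s1 s2 m)
    \<le> real (3 * (n + 1) ^ (2 * b)) ^ k * (N choose (s1 + s2))"
proof -
  have \<epsilon>: "0 < \<epsilon>" "\<epsilon> \<le> 1"
    using \<eta> power_le_one[of \<eta> 5] by (auto simp: \<epsilon>_def)
  define \<beta> where "\<beta> = real (subgroup_beta G ((1 + 2 * \<eta>) * m))"
  have "card (sumset_pairs G s1 s2 m F1 F2 {}) \<le> real (3 * (n + 1) ^ (2 * b)) ^ k * (N choose (s1 + s2))"
  proof (rule card_sumset_pairs_le[OF \<epsilon> s b])
    show "8 / \<epsilon> * (ln (card F1) + ln (card F2)) + (real m - card {}) * (4 / (\<epsilon> * real b ^ 2)) < k"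
      using k F by simp
    fix B1 B2 C
    assume B: "finite B1" "finite B2" "finite C" "B1 \<subseteq> carrier G" "B2 \<subseteq> carrier G" "B1 \<noteq> {}" "B2 \<noteq> {}"
      "card C \<le> m" and or: "card B1 + card B2 \<le> m \<or>
         card {p \<in> B1 \<times> B2. fst p \<otimes> snd p \<notin> C} \<le> \<epsilon> * (card B1 * card B2)"
    have "real (card B1) + card B2 \<le> (1 + 4 * \<eta>) * (m + \<beta>)"
      using or
    proof
      assume "card B1 + card B2 \<le> m"
      then have "real (card B1) + card B2 \<le> m" by linarith
      also have "\<dots> \<le> (1 + 4 * \<eta>) * (m + \<beta>)"
        using \<eta> by (simp add: \<beta>_def algebra_simps)
      finally show ?thesis .
    next
      assume "card {p \<in> B1 \<times> B2. fst p \<otimes> snd p \<notin> C} \<le> \<epsilon> * (card B1 * card B2)"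
      then obtain H where H: "subgroup H G" "finite H" "card H \<le> (1 + 2 * \<eta>) * card C"
        "real (card B1) + card B2 \<le> (1 + 4 * \<eta>) * (real (card C) + card H)"
        using robust_kneser_symmetric[OF B(1-5) \<eta> B(6,7)] unfolding \<epsilon>_def by blast
      have "(1 + 2 * \<eta>) * card C \<le> (1 + 2 * \<eta>) * m" using B(8) \<eta> by (intro mult_left_mono) auto
      then have "card H \<le> subgroup_beta G ((1 + 2 * \<eta>) * m)"
        using H by (intro card_le_subgroup_beta) auto
      then have "real (card C) + card H \<le> m + \<beta>" using B(8) by (simp add: \<beta>_def)
      then have "(1 + 4 * \<eta>) * (real (card C) + card H) \<le> (1 + 4 * \<eta>) * (m + \<beta>)"
        using \<eta> by (intro mult_left_mono) auto
      then show ?thesis using H(4) by simp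
    qed
    then have le: "card B1 + card B2 \<le> N" unfolding N \<beta>_def[symmetric] by (intro le_nat_floor) simp
    \<comment> \<open>The product is one summand of Vandermonde's convolution.\<close>
    have "(card B1 choose s1) * (card B2 choose s2)
      \<le> (\<Sum>k\<le>s1 + s2. (card B1 choose k) * (card B2 choose (s1 + s2 - k)))"
      using member_le_sum[of s1 "{..s1 + s2}" "\<lambda>k. (card B1 choose k) * (card B2 choose (s1 + s2 - k))"] by simp
    also have "\<dots> = (card B1 + card B2) choose (s1 + s2)" by (simp add: vandermonde)
    also have "\<dots> \<le> N choose (s1 + s2)" using le by (rule binomial_right_mono)
    finally show "real ((card B1 choose s1) * (card B2 choose s2)) \<le> real (N choose (s1 + s2))"
      by (rule of_nat_mono)
  qed (use F in auto)
  moreover have "small_sumset_pairs G F1 F2 s1 s2 m = sumset_pairs G s1 s2 m F1 F2 {}"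
    by (simp add: small_sumset_pairs_def sumset_pairs_def)
  ultimately show ?thesis by simp
qed

end

section \<open>Binomial coefficients\<close>

text \<open>The logarithm of the Stirling-type bound \<open>k! \<le> e k (k / e)^k\<close>. The
  induction step reduces to \<open>(k + 1) * ln (k / (k + 1)) \<le> -1\<close>.\<close>

lemma ln_fact_le:
  assumes "1 \<le> k"
  shows "ln (fact k) \<le> 1 + ln (real k) + real k * ln (real k) - real k"
  using assms
proof (induction k rule: dec_induct)
  case base
  then show ?case by simp
next
  case (step k)
  have k: "0 < real k" using step by simp
  have "ln (real k / (real k + 1)) \<le> real k / (real k + 1) - 1" using k by (intro ln_le_minus_one) simp
  then have "ln (real k) - ln (real k + 1) \<le> - 1 / (real k + 1)"
    using k by (simp add: ln_div field_simps)
  then have "(real k + 1) * (ln (real k) - ln (real k + 1)) \<le> (real k + 1) * (- 1 / (real k + 1))"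
    using k by (intro mult_left_mono) auto
  then have "(real k + 1) * (ln (real k) - ln (real k + 1)) \<le> - 1" using k by simp
  moreover have "ln (fact (Suc k)) = ln (real k + 1) + ln (fact k)"
    using k by (simp add: ln_mult add.commute)
  ultimately show ?case using step by (simp add: algebra_simps)
qed

text \<open>The exponent is the integral of \<open>ln\<close> from \<open>y - k\<close> to
  \<open>y\<close>. On each unit interval the integral is at most the value at the right end, which
  is the inequality \<open>key\<close>.\<close>

lemma prod_diff_ge:
  fixes y :: real
  assumes "real k \<le> y"
  shows "exp (y * ln y - (y - k) * ln (y - k) - k) \<le> (\<Prod>i<k. y - real i)"
  using assms
proof (induction k)
  case (Suc k)
  define z where "z = y - k"
  have z: "1 \<le> z" using Suc by (simp add: z_def)
  have key: "z * ln z - (z - 1) * ln (z - 1) - 1 \<le> ln z"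
  \<comment> \<open>At \<open>z = 1\<close> the term \<open>(z - 1) * ln (z - 1)\<close> vanishes
    because of its first factor.\<close>
  proof (cases "z = 1")
    case False
    then have z1: "0 < z - 1" using z by simp
    have "ln (z / (z - 1)) \<le> z / (z - 1) - 1" using z1 by (intro ln_le_minus_one) simp
    also have "\<dots> = 1 / (z - 1)" using z1 by (simp add: field_simps)
    finally have "(z - 1) * (ln z - ln (z - 1)) \<le> (z - 1) * (1 / (z - 1))"
      using z1 by (intro mult_left_mono) (auto simp: ln_div)
    then show ?thesis using z1 by (simp add: algebra_simps)
  qed simp
  have "exp (y * ln y - (y - Suc k) * ln (y - Suc k) - Suc k)
     = exp (y * ln y - (y - k) * ln (y - k) - k) * exp (z * ln z - (z - 1) * ln (z - 1) - 1)"
    by (simp add: z_def exp_add[symmetric] algebra_simps)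
  also have "\<dots> \<le> (\<Prod>i<k. y - real i) * exp (ln z)"
  proof (rule mult_mono)
    show "exp (y * ln y - (y - k) * ln (y - k) - k) \<le> (\<Prod>i<k. y - real i)" using Suc by simp
    show "0 \<le> (\<Prod>i<k. y - real i)" using Suc.prems by (intro prod_nonneg) auto
  qed (use key in auto)
  also have "\<dots> = (\<Prod>i<Suc k. y - real i)" using z by (simp add: z_def)
  finally show ?case .
qed simp

text \<open>Divide the falling factorial by the Stirling-type bound for \<open>fact k\<close>. The
  exponent on the left is \<open>y\<close> times the entropy of \<open>k / y\<close> in natural
  units, and the factor \<open>exp 1 * k\<close> is the loss.\<close>

lemma gchoose_ge:
  fixes y :: real
  assumes "1 \<le> k" "real k \<le> y"
  shows "exp (y * ln y - (y - k) * ln (y - k) - k * ln k) \<le> exp 1 * k * (y gchoose k)"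
proof -
  have "exp (y * ln y - (y - k) * ln (y - k) - k) \<le> (y gchoose k) * fact k"
    using prod_diff_ge[OF assms(2)] by (simp add: gbinomial_prod_rev lessThan_atLeast0)
  also have "\<dots> \<le> (y gchoose k) * exp (1 + ln k + k * ln k - k)"
  proof (rule mult_left_mono)
    have "fact k = exp (ln (fact k :: real))" by simp
    also have "\<dots> \<le> exp (1 + ln k + k * ln k - k)"
      using ln_fact_le[OF assms(1)] by (subst exp_le_cancel_iff)
    finally show "fact k \<le> exp (1 + ln k + k * ln k - k)" .
    have "0 \<le> (\<Prod>i<k. y - real i)" using assms by (intro prod_nonneg) auto
    then show "0 \<le> y gchoose k" by (simp add: gbinomial_prod_rev lessThan_atLeast0)
  qed
  finally have "exp (y * ln y - (y - k) * ln (y - k) - k) * exp (k - k * ln k)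
     \<le> (y gchoose k) * exp (1 + ln k + k * ln k - k) * exp (k - k * ln k)"
    by (intro mult_right_mono) auto
  moreover have "exp (1 + ln k + k * ln k - k) * exp (k - k * ln k) = exp 1 * k"
    using assms by (simp add: exp_add[symmetric] exp_add)
  ultimately show ?thesis by (simp add: exp_add[symmetric] mult_ac)
qed

text \<open>A single term of the expansion of \<open>(s + (N - s)) ^ N\<close> is at most the whole
  sum.\<close>

lemma binomial_le_exp:
  assumes "s \<le> N"
  shows "real (N choose s) \<le> exp (N * ln N - (real N - s) * ln (real N - s) - s * ln s)"
proof -
  \<comment> \<open>For \<open>k = 0\<close> both sides are 1, so the extreme cases
    \<open>s = 0\<close> and \<open>s = N\<close> are included.\<close>
  have p: "real k ^ k = exp (k * ln k)" for k :: nat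
    by (cases "k = 0") (auto simp: exp_of_nat_mult)
  have "real (N choose s) * (real s ^ s * real (N - s) ^ (N - s)) \<le> (\<Sum>k\<le>N. real (N choose k) * real s ^ k * real (N - s) ^ (N - k))"
    using member_le_sum[of s "{..N}" "\<lambda>k. real (N choose k) * real s ^ k * real (N - s) ^ (N - k)"] assms
    by (simp add: mult_ac)
  also have "\<dots> = (real s + real (N - s)) ^ N" by (simp add: binomial_ring)
  also have "\<dots> = exp (N * ln N)" using assms p[of N] by (simp flip: of_nat_add)
  also have "real s ^ s * real (N - s) ^ (N - s) = exp (s * ln s + (real N - s) * ln (real N - s))"
    unfolding p using assms by (simp add: exp_add of_nat_diff)
  finally have "real (N choose s) * exp (s * ln s + (real N - s) * ln (real N - s)) \<le> exp (N * ln N)" .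
  then have "real (N choose s) * exp (s * ln s + (real N - s) * ln (real N - s)) * exp (- (s * ln s + (real N - s) * ln (real N - s)))
     \<le> exp (N * ln N) * exp (- (s * ln s + (real N - s) * ln (real N - s)))"
    by (intro mult_right_mono) auto
  then show ?thesis by (simp add: exp_add[symmetric] mult.assoc algebra_simps)
qed

text \<open>The function \<open>x ln x - (x - s) ln (x - s)\<close> has derivative
  \<open>ln (x / (x - s))\<close>, which is of order \<open>s / x\<close> for
  \<open>x \<ge> 2 * s\<close> and is handled by the mean value theorem there. The derivative is
  unbounded near \<open>x = s\<close>; for \<open>y < 2 * s\<close> the increment is bounded by
  \<open>\<Delta> + \<Delta> * ln (y' / \<Delta>)\<close>, and this is the source of the square root
  of \<open>\<theta>\<close>.\<close>

lemma entropy_increment_le: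
  fixes \<theta> y y' s :: real
  assumes \<theta>: "0 < \<theta>" "\<theta> \<le> 1" and s: "0 < s" "s \<le> y" and y': "y \<le> y'" "y' \<le> (1 + \<theta>) * y"
  shows "y' * ln y' - (y' - s) * ln (y' - s) \<le> y * ln y - (y - s) * ln (y - s) + 8 * sqrt \<theta> * s"
proof (cases "y = y'")
  case True
  then show ?thesis using assms by simp
next
  case False
  then have lt: "y < y'" using y' by simp
  have \<theta>r: "\<theta> \<le> sqrt \<theta>" using \<theta> by (intro real_le_rsqrt) (simp add: power2_eq_square mult_left_le)
  define \<Delta> where "\<Delta> = y' - y"
  have \<Delta>: "0 < \<Delta>" "\<Delta> \<le> \<theta> * y" using lt y' by (auto simp: \<Delta>_def algebra_simps)
  show ?thesis
  proof (cases "2 * s \<le> y")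
    case True
    have "\<exists>z. y < z \<and> z < y' \<and>
      (y' * ln y' - (y' - s) * ln (y' - s)) - (y * ln y - (y - s) * ln (y - s)) = (y' - y) * (ln z - ln (z - s))"
    proof (rule MVT2[OF lt])
      fix x assume "y \<le> x" "x \<le> y'"
      then have "0 < x" "0 < x - s" using s True by auto
      then show "((\<lambda>x. x * ln x - (x - s) * ln (x - s)) has_real_derivative ln x - ln (x - s)) (at x)"
        by (auto intro!: derivative_eq_intros)
    qed
    then obtain z where z: "y < z" "z < y'" and eq:
      "(y' * ln y' - (y' - s) * ln (y' - s)) - (y * ln y - (y - s) * ln (y - s)) = \<Delta> * (ln z - ln (z - s))"
      by (auto simp: \<Delta>_def)
    have zs: "0 < z - s" "0 < z" "y / 2 \<le> z - s" using z True s by auto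
    have "ln z - ln (z - s) = ln (z / (z - s))" using zs by (simp add: ln_div)
    also have "\<dots> \<le> z / (z - s) - 1" using zs by (intro ln_le_minus_one) simp
    also have "\<dots> = s / (z - s)" using zs by (simp add: field_simps)
    also have "\<dots> \<le> s / (y / 2)" using zs s True by (intro divide_left_mono) auto
    finally have "\<Delta> * (ln z - ln (z - s)) \<le> \<Delta> * (s / (y / 2))" using \<Delta> by (intro mult_left_mono) auto
    also have "\<dots> \<le> \<theta> * y * (s / (y / 2))" using \<Delta> s True by (intro mult_right_mono) auto
    also have "\<dots> = 2 * \<theta> * s" using s by simp
    also have "\<dots> \<le> 8 * sqrt \<theta> * s" using \<theta>r \<theta> s by (intro mult_right_mono) auto
    finally show ?thesis using eq by simp
  next
    case False
    define w where "w = y - s"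
    have w: "0 \<le> w" using s by (simp add: w_def)
    have y0: "0 < y" using s by simp
    have "ln (y' / y) \<le> y' / y - 1" using lt y0 by (intro ln_le_minus_one) simp
    then have "y * (ln y' - ln y) \<le> y * (y' / y - 1)"
      using lt y0 by (intro mult_left_mono) (auto simp: ln_div)
    moreover have "y * (y' / y - 1) = \<Delta>" using y0 by (simp add: \<Delta>_def field_simps)
    ultimately have "y * (ln y' - ln y) \<le> \<Delta>" by simp
    then have 1: "y' * ln y' - y * ln y \<le> \<Delta> * (ln y' + 1)" by (simp add: \<Delta>_def algebra_simps)
    have "w * ln w \<le> w * ln (w + \<Delta>)" using w \<Delta> by (cases "w = 0") (auto intro!: mult_left_mono)
    then have 2: "\<Delta> * ln (w + \<Delta>) \<le> (w + \<Delta>) * ln (w + \<Delta>) - w * ln w" by (simp add: algebra_simps)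
    have "ln \<Delta> \<le> ln (w + \<Delta>)" using w \<Delta> by simp
    then have "\<Delta> * ln \<Delta> \<le> \<Delta> * ln (w + \<Delta>)" using \<Delta> by (intro mult_left_mono) auto
    moreover have "y' - s = w + \<Delta>" by (simp add: w_def \<Delta>_def)
    ultimately have 3: "(y' * ln y' - (y' - s) * ln (y' - s)) - (y * ln y - (y - s) * ln (y - s))
       \<le> \<Delta> + \<Delta> * (ln y' - ln \<Delta>)"
      using 1 2 unfolding w_def[symmetric] by (simp add: algebra_simps)
    \<comment> \<open>Halving the logarithm before \<open>ln x \<le> x\<close> is used keeps a
      factor of the square root of \<open>\<Delta>\<close>.\<close>
    have "ln y' - ln \<Delta> = 2 * ln (sqrt (y' / \<Delta>))"
      using \<Delta> lt y0 by (simp add: ln_sqrt ln_div)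
    also have "\<dots> \<le> 2 * sqrt (y' / \<Delta>)"
      using ln_le_minus_one[of "sqrt (y' / \<Delta>)"] \<Delta> lt y0 by simp
    finally have "\<Delta> * (ln y' - ln \<Delta>) \<le> \<Delta> * (2 * sqrt (y' / \<Delta>))" using \<Delta> by (intro mult_left_mono) auto
    also have "\<dots> = 2 * sqrt (y' * \<Delta>)"
    proof -
      have "\<Delta> * sqrt (y' / \<Delta>) = sqrt (\<Delta>\<^sup>2 * (y' / \<Delta>))" 
        unfolding real_sqrt_mult using \<Delta> by simp
      also have "\<Delta>\<^sup>2 * (y' / \<Delta>) = y' * \<Delta>" using \<Delta> by (simp add: power2_eq_square)
      finally show ?thesis by simp
    qed
    also have "sqrt (y' * \<Delta>) \<le> sqrt (8 * \<theta> * s\<^sup>2)"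
    proof (rule real_sqrt_le_mono)
      have "\<theta> * y \<le> 1 * y" using \<theta> y0 by (intro mult_right_mono) auto
      then have "y' \<le> 4 * s" using y' False by (simp add: algebra_simps)
      moreover have "\<Delta> \<le> \<theta> * (2 * s)"
        using \<Delta> False \<theta> mult_left_mono[of y "2 * s" \<theta>] by linarith
      ultimately have "y' * \<Delta> \<le> (4 * s) * (\<theta> * (2 * s))" using \<Delta> s by (intro mult_mono) auto
      then show "y' * \<Delta> \<le> 8 * \<theta> * s\<^sup>2" by (simp add: power2_eq_square mult_ac)
    qed
    also have "\<dots> \<le> 3 * sqrt \<theta> * s"
    proof -
      have "sqrt (8 * \<theta> * s\<^sup>2) \<le> sqrt (9 * \<theta> * s\<^sup>2)" using \<theta> s by simp
      also have "\<dots> = 3 * sqrt \<theta> * s" using s by (simp add: real_sqrt_mult)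
      finally show ?thesis .
    qed
    finally have 4: "\<Delta> * (ln y' - ln \<Delta>) \<le> 6 * sqrt \<theta> * s" by simp
    have "\<Delta> \<le> \<theta> * (2 * s)" using \<Delta> False \<theta> mult_left_mono[of y "2 * s" \<theta>] by linarith
    also have "\<dots> \<le> sqrt \<theta> * (2 * s)" using \<theta>r s by (intro mult_right_mono) auto
    finally show ?thesis using 3 4 by simp
  qed
qed

text \<open>The entropy exponent is homogeneous of degree one: with \<open>r = M / (s1 + s2)\<close>
  it equals \<open>(s1 + s2) * \<phi>\<close>, where \<open>\<phi>\<close> depends on
  \<open>r\<close> alone. As \<open>a1 * M = s1 * r\<close> and \<open>a2 * M = s2 * r\<close>, it
  splits exactly into the exponents of the two factors.\<close>

lemma binomial_le_gchoose_mult: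
  fixes \<theta> a1 a2 :: real and M N s1 s2 :: nat
  assumes \<theta>: "0 < \<theta>" "\<theta> \<le> 1" and s: "1 \<le> s1" "1 \<le> s2" "s1 + s2 \<le> M"
    and N: "real N \<le> (1 + \<theta>) * M"
  defines "a1 \<equiv> real s1 / (real s1 + real s2)" and "a2 \<equiv> real s2 / (real s1 + real s2)"
  shows "real (N choose (s1 + s2)) \<le> exp (8 * sqrt \<theta> * (s1 + s2)) * (exp 1 * s1) * (exp 1 * s2)
     * ((a1 * M) gchoose s1) * ((a2 * M) gchoose s2)"
proof -
  define s where "s = s1 + s2"
  \<comment> \<open>The maximum guarantees \<open>s \<le> N'\<close> and \<open>M \<le> N'\<close>,
    also when \<open>N\<close> falls below \<open>s\<close>.\<close>
  define N' where "N' = max N M"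
  define r where "r = real M / s"
  have spos: "0 < real s" using assms by (simp add: s_def)
  have r: "1 \<le> r" using assms by (simp add: r_def s_def field_simps)
  define \<phi> where "\<phi> = r * ln r - (r - 1) * ln (r - 1)"
  have scale: "k * r * ln (k * r) - (k * r - k) * ln (k * r - k) - k * ln k = k * \<phi>" if "0 < k" for k :: real
  proof (cases "r = 1")
    case True
    then show ?thesis by (simp add: \<phi>_def)
  next
    case False
    have "ln (k * r - k) = ln (k * (r - 1))" by (simp add: algebra_simps)
    also have "\<dots> = ln k + ln (r - 1)" using that False r by (intro ln_mult_pos) auto
    finally have "ln (k * r - k) = ln k + ln (r - 1)" .
    moreover have "ln (k * r) = ln k + ln r" using that r by (intro ln_mult_pos) auto
    ultimately show ?thesis by (simp add: \<phi>_def algebra_simps)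
  qed
  have a: "a1 * M = s1 * r" "a2 * M = s2 * r" by (auto simp: a1_def a2_def r_def s_def)
  have low: "exp (k * \<phi>) \<le> exp 1 * k * ((k * r) gchoose k)" if "1 \<le> k" for k :: nat
  proof -
    have "real k \<le> k * r" using r by (simp add: mult_le_cancel_left1)
    from gchoose_ge[OF that this] show ?thesis using scale[of "real k"] that by simp
  qed
  have "real (N choose s) \<le> real (N' choose s)" unfolding N'_def by (simp add: binomial_right_mono)
  also have "\<dots> \<le> exp (N' * ln N' - (real N' - s) * ln (real N' - s) - s * ln s)"
    using assms by (intro binomial_le_exp) (auto simp: N'_def s_def)
  also have "\<dots> \<le> exp (M * ln M - (real M - s) * ln (real M - s) + 8 * sqrt \<theta> * s - s * ln s)"
  proof -
    have "real M \<le> (1 + \<theta>) * M" using \<theta> by (simp add: algebra_simps)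
    then have "real N' \<le> (1 + \<theta>) * M" using N by (simp add: N'_def)
    then have "N' * ln N' - (real N' - s) * ln (real N' - s)
        \<le> M * ln M - (real M - s) * ln (real M - s) + 8 * sqrt \<theta> * s"
      using assms spos by (intro entropy_increment_le) (auto simp: N'_def s_def)
    then show ?thesis by simp
  qed
  also have "\<dots> = exp (8 * sqrt \<theta> * s) * exp (s1 * \<phi>) * exp (s2 * \<phi>)"
  proof -
    have "real M = s * r" using spos by (simp add: r_def)
    then have "M * ln M - (real M - s) * ln (real M - s) - s * ln s = s * \<phi>"
      using scale[OF spos] by simp
    then have eq: "M * ln M - (real M - s) * ln (real M - s) + 8 * sqrt \<theta> * s - s * ln s
       = 8 * sqrt \<theta> * s + s1 * \<phi> + s2 * \<phi>" by (simp add: s_def algebra_simps)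
    show ?thesis unfolding eq exp_add ..
  qed
  also have "\<dots> \<le> exp (8 * sqrt \<theta> * s) * (exp 1 * s1 * ((s1 * r) gchoose s1)) * (exp 1 * s2 * ((s2 * r) gchoose s2))"
    using low[OF s(1)] low[OF s(2)] by (intro mult_mono mult_left_mono)
      (auto intro!: order_trans[OF exp_ge_zero low[OF s(1)]] order_trans[OF exp_ge_zero low[OF s(2)]] mult_nonneg_nonneg)
  finally show ?thesis by (simp add: a s_def mult_ac)
qed

lemma gchoose_ge_1:
  fixes x :: real
  assumes "real k \<le> x"
  shows "1 \<le> x gchoose k"
proof -
  have "1 \<le> (x / real k) ^ k" using assms by (cases "k = 0") (auto intro!: one_le_power)
  also have "\<dots> \<le> x gchoose k" using assms by (rule gbinomial_ge_n_over_k_pow_k)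
  finally show ?thesis .
qed

section \<open>Choice of parameters and asymptotics\<close>

text \<open>With \<open>b\<^sup>2\<close> about \<open>\<epsilon> * m / (16 * ln n)\<close> both
  terms of the depth are of order \<open>ln n\<close>. The total cost \<open>k * b * ln n\<close> is
  then of order \<open>b * (ln n)\<^sup>2\<close>, that is, the square root of
  \<open>m * (ln n)^3\<close>.\<close>

lemma container_parameters:
  fixes \<epsilon> :: real and n m b k :: nat
  assumes \<epsilon>: "0 < \<epsilon>" "\<epsilon> \<le> 1" and n: "3 \<le> n" and m: "16 * ln n \<le> \<epsilon> * m"
    and b: "b = nat \<lfloor>sqrt (\<epsilon> * m / (16 * ln n))\<rfloor>"
    and k: "k = nat \<lfloor>16 / \<epsilon> * ln n + m * (4 / (\<epsilon> * real b ^ 2))\<rfloor> + 1"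
  shows "0 < b" "real b \<le> sqrt (m * ln n ^ 3)" "16 * real b ^ 2 \<le> \<epsilon> * m"
    "16 / \<epsilon> * ln n + m * (4 / (\<epsilon> * real b ^ 2)) < k"
    "real (3 * (n + 1) ^ (2 * b)) ^ k \<le> exp (1400 / \<epsilon>\<^sup>2 * sqrt (m * ln n ^ 3))"
proof -
  define l where "l = ln (real n)"
  define x where "x = sqrt (\<epsilon> * m / (16 * l))"
  have "exp 1 \<le> real n" using n exp_le by linarith
  then have l: "1 \<le> l" unfolding l_def using n by (simp add: ln_ge_iff)
  have x2: "x\<^sup>2 = \<epsilon> * m / (16 * l)" using \<epsilon> l by (simp add: x_def)
  have "1 \<le> \<epsilon> * m / (16 * l)" using m l by (simp add: l_def)
  then have x: "1 \<le> x" by (simp add: x_def)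
  have bx: "real b \<le> x" "x - 1 < b" unfolding b x_def[symmetric] l_def[symmetric]
    using x by (auto simp: le_nat_floor)
  show b0: "0 < b" using bx x by (cases "b = 0") auto
  \<comment> \<open>For \<open>x \<ge> 2\<close> this follows from \<open>x - 1 < b\<close>, and for
    \<open>x < 2\<close> from \<open>1 \<le> b\<close>.\<close>
  then have "x / 2 \<le> b" using bx by (cases "2 \<le> x") auto
  then have "(x / 2)\<^sup>2 \<le> real b ^ 2" using x by (intro power_mono) auto
  then have b2: "\<epsilon> * m / (64 * l) \<le> real b ^ 2" using x2 by (simp add: power_divide)
  have b2': "real b ^ 2 \<le> \<epsilon> * m / (16 * l)" unfolding x2[symmetric] using bx by (intro power_mono) auto
  have "16 * l * real b ^ 2 \<le> \<epsilon> * m" using b2' l by (simp add: field_simps)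
  moreover have "16 * real b ^ 2 \<le> 16 * l * real b ^ 2" using l by (intro mult_right_mono) auto
  ultimately show "16 * real b ^ 2 \<le> \<epsilon> * m" by linarith
  have em: "\<epsilon> * m \<le> m" using \<epsilon> by (simp add: mult_left_le_one_le)
  have "0 \<le> l * real b ^ 2" using l by simp
  then have "l * real b ^ 2 \<le> m"
    using \<open>16 * l * real b ^ 2 \<le> \<epsilon> * m\<close> em by linarith
  then have "l ^ 3 * (l * real b ^ 2) \<le> l ^ 3 * m" using l by (intro mult_left_mono) auto
  then have bl: "(real b * l\<^sup>2)\<^sup>2 \<le> m * l ^ 3" by (simp add: eval_nat_numeral mult_ac)
  then have bl': "real b * l\<^sup>2 \<le> sqrt (m * l ^ 3)" by (rule real_le_rsqrt)
  moreover have "real b * 1 \<le> real b * l\<^sup>2" using l by (intro mult_left_mono) (auto simp: one_le_power)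
  ultimately show "real b \<le> sqrt (m * ln n ^ 3)" unfolding l_def by linarith
  define \<phi> where "\<phi> = 16 / \<epsilon> * l + m * (4 / (\<epsilon> * real b ^ 2))"
  have \<phi>0: "0 \<le> \<phi>" using \<epsilon> l by (simp add: \<phi>_def)
  have k': "real k \<le> \<phi> + 1" "\<phi> < k" unfolding k \<phi>_def[symmetric] l_def[symmetric]
    using \<phi>0 by linarith+
  then show "16 / \<epsilon> * ln n + m * (4 / (\<epsilon> * real b ^ 2)) < k" by (simp add: \<phi>_def l_def)
  have "m * (4 / (\<epsilon> * real b ^ 2)) \<le> 256 / \<epsilon>\<^sup>2 * l"
  proof -
    have "m * 4 * \<epsilon> \<le> 256 * l * real b ^ 2" using b2 l by (simp add: field_simps)
    then have "m * 4 / (\<epsilon> * real b ^ 2) \<le> 256 * l / \<epsilon>\<^sup>2" using b0 \<epsilon> by (simp add: field_simps power2_eq_square)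
    then show ?thesis by simp
  qed
  moreover have "16 / \<epsilon> * l \<le> 16 / \<epsilon>\<^sup>2 * l"
    using \<epsilon> l by (intro mult_right_mono divide_left_mono) (auto simp: power2_eq_square mult_left_le_one_le)
  moreover have "1 \<le> 1 / \<epsilon>\<^sup>2 * l"
  proof -
    have "1 \<le> 1 / \<epsilon>\<^sup>2" using \<epsilon> by (simp add: power_le_one)
    then show ?thesis using l mult_mono[of 1 "1 / \<epsilon>\<^sup>2" 1 l] by simp
  qed
  \<comment> \<open>Here \<open>273 = 16 + 256 + 1\<close>; together with the factor 5 below it
    gives \<open>1365 \<le> 1400\<close>.\<close>
  ultimately have kle: "real k \<le> 273 / \<epsilon>\<^sup>2 * l" using k' by (simp add: \<phi>_def)
  have "ln 3 \<le> l" unfolding l_def using n by simp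
  moreover have "ln (real n + 1) \<le> 2 * l"
  proof -
    have "n + 1 \<le> n * n" using n mult_le_mono1[of 3 n n] by linarith
    then have "real (n + 1) \<le> real (n * n)" by (rule of_nat_mono)
    then have "ln (real n + 1) \<le> ln (real n * real n)" using n by simp
    also have "\<dots> = 2 * l" unfolding l_def using n by (subst ln_mult) auto
    finally show ?thesis .
  qed
  ultimately have "ln 3 + 2 * b * ln (real n + 1) \<le> l + 2 * b * (2 * l)"
    by (intro add_mono mult_left_mono) auto
  also have "\<dots> \<le> 5 * (b * l)" using l b0 mult_right_mono[of 1 "real b" l] by simp
  finally have lnB: "ln 3 + 2 * b * ln (real n + 1) \<le> 5 * (b * l)" .
  have "real (3 * (n + 1) ^ (2 * b)) = 3 * (real n + 1) ^ (2 * b)" by (simp add: add.commute)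
  also have "\<dots> = exp (ln 3 + 2 * b * ln (real n + 1))"
    using exp_of_nat_mult[of "2 * b" "ln (real n + 1)"] by (simp add: exp_add)
  finally have "real (3 * (n + 1) ^ (2 * b)) ^ k = exp (k * (ln 3 + 2 * b * ln (real n + 1)))"
    by (simp add: exp_of_nat_mult)
  also have "\<dots> \<le> exp (1400 / \<epsilon>\<^sup>2 * sqrt (m * l ^ 3))"
  proof -
    have "k * (ln 3 + 2 * b * ln (real n + 1)) \<le> (273 / \<epsilon>\<^sup>2 * l) * (5 * (b * l))"
      using kle lnB l by (intro mult_mono) auto
    also have "\<dots> = 1365 / \<epsilon>\<^sup>2 * (real b * l\<^sup>2)" by (simp add: power2_eq_square)
    also have "\<dots> \<le> 1400 / \<epsilon>\<^sup>2 * sqrt (m * l ^ 3)"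
      using bl' \<epsilon> by (intro mult_mono divide_right_mono) auto
    finally show ?thesis by simp
  qed
  finally show "real (3 * (n + 1) ^ (2 * b)) ^ k \<le> exp (1400 / \<epsilon>\<^sup>2 * sqrt (m * ln n ^ 3))"
    by (simp add: l_def)
qed

text \<open>The claimed bound without its power of two, with the argument \<open>t\<close> of
  \<beta> kept as a parameter.\<close>

definition pair_count_bound ::
    "('a, 'b) monoid_scheme \<Rightarrow> real \<Rightarrow> nat \<Rightarrow> nat \<Rightarrow> nat \<Rightarrow> real" where
  "pair_count_bound G t s1 s2 m =
     ((real s1 / (real s1 + real s2) * (real m + real (subgroup_beta G t))) gchoose s1) *
     ((real s2 / (real s1 + real s2) * (real m + real (subgroup_beta G t))) gchoose s2)"

text \<open>From \<open>s1 + s2 \<le> m\<close> the upper arguments are at least \<open>s1\<close>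
  and \<open>s2\<close>. Being at least 1, the bound may be multiplied by larger powers of two, and
  such a power alone can absorb a trivial estimate.\<close>

lemma pair_count_bound_ge_1:
  assumes "s1 + s2 \<le> m"
  shows "1 \<le> pair_count_bound G t s1 s2 m"
proof -
  have "real s \<le> real s / (real s1 + real s2) * (real m + real (subgroup_beta G t))"
    if "s = s1 \<or> s = s2" for s
  proof (cases "s1 + s2 = 0")
    case False
    then have pos: "0 < real s1 + real s2" by linarith
    have "real s1 + real s2 \<le> real m + real (subgroup_beta G t)" using assms by linarith
    then have "real s / (real s1 + real s2) * (real s1 + real s2)
       \<le> real s / (real s1 + real s2) * (real m + real (subgroup_beta G t))"
      by (intro mult_left_mono) auto
    then show ?thesis using pos by simp
  qed (use that in auto)
  then have "1 * 1 \<le> pair_count_bound G t s1 s2 m"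
    unfolding pair_count_bound_def by (intro mult_mono gchoose_ge_1) (auto intro: order_trans[OF _ gchoose_ge_1])
  then show ?thesis by simp
qed

text \<open>The three losses add up in the exponent: the number of terminal states, the entropy
  increment with \<open>\<theta> = 4 * \<eta>\<close>, where \<open>s1 + s2 \<le> 2 * s2\<close>,
  and the two Stirling factors, which are at most \<open>exp (1 + ln s2)\<close> each.\<close>

lemma (in comm_group) card_small_sumset_pairs_le_exp:
  fixes \<eta> \<epsilon> :: real and n s1 s2 m :: nat
  defines "\<epsilon> \<equiv> \<eta> ^ 5 / 2048"
  assumes \<eta>: "0 < \<eta>" "\<eta> \<le> 1 / 4" and n: "3 \<le> n" and s: "1 \<le> s1" "s1 \<le> s2" "s1 + s2 \<le> m"
    and m: "16 * ln n \<le> \<epsilon> * m" "4 * sqrt (m * ln n ^ 3) \<le> \<epsilon> * s1"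
    and F: "finite F1" "finite F2" "F1 \<subseteq> carrier G" "F2 \<subseteq> carrier G" "card F1 = n" "card F2 = n"
  shows "card (small_sumset_pairs G F1 F2 s1 s2 m)
    \<le> exp (1400 / \<epsilon>\<^sup>2 * sqrt (m * ln n ^ 3) + 32 * sqrt \<eta> * s2 + 2 + 2 * ln s2)
      * pair_count_bound G ((1 + 2 * \<eta>) * m) s1 s2 m"
proof -
  have \<epsilon>: "0 < \<epsilon>" "\<epsilon> \<le> 1"
    using \<eta> power_le_one[of \<eta> 5] by (auto simp: \<epsilon>_def)
  define b where "b = nat \<lfloor>sqrt (\<epsilon> * m / (16 * ln n))\<rfloor>"
  define k where "k = nat \<lfloor>16 / \<epsilon> * ln n + m * (4 / (\<epsilon> * real b ^ 2))\<rfloor> + 1"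
  note par = container_parameters[OF \<epsilon> n m(1) b_def k_def]
  define M where "M = m + subgroup_beta G ((1 + 2 * \<eta>) * m)"
  define N where "N = nat \<lfloor>(1 + 4 * \<eta>) * (m + real (subgroup_beta G ((1 + 2 * \<eta>) * m)))\<rfloor>"
  have b1: "4 * real b \<le> \<epsilon> * s1" using par(2) m(2) by simp
  also have "\<dots> \<le> \<epsilon> * s2" using s \<epsilon> by simp
  finally have b2: "4 * real b \<le> \<epsilon> * s2" .
  have "real (card (small_sumset_pairs G F1 F2 s1 s2 m))
    \<le> real (3 * (n + 1) ^ (2 * b)) ^ k * (N choose (s1 + s2))"
    using card_small_sumset_pairs_le[of \<eta> s1 s2 b m F1 F2 n k N] \<eta> s par b1 b2 F N_def
    unfolding \<epsilon>_def by simp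
  also have "\<dots> \<le> exp (1400 / \<epsilon>\<^sup>2 * sqrt (m * ln n ^ 3)) * (N choose (s1 + s2))"
    using par(5) by (intro mult_right_mono) auto
  also have "\<dots> \<le> exp (1400 / \<epsilon>\<^sup>2 * sqrt (m * ln n ^ 3)) *
      (exp (32 * sqrt \<eta> * s2 + 2 + 2 * ln s2) * pair_count_bound G ((1 + 2 * \<eta>) * m) s1 s2 m)"
  proof (rule mult_left_mono)
    have "0 \<le> (1 + 4 * \<eta>) * (m + real (subgroup_beta G ((1 + 2 * \<eta>) * m)))" using \<eta> by simp
    then have "real N \<le> (1 + 4 * \<eta>) * M" unfolding N_def M_def by simp
    then have "real (N choose (s1 + s2)) \<le> exp (8 * sqrt (4 * \<eta>) * (s1 + s2)) * (exp 1 * s1) * (exp 1 * s2)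
     * ((s1 / (real s1 + real s2) * M) gchoose s1) * ((s2 / (real s1 + real s2) * M) gchoose s2)"
      using \<eta> s by (intro binomial_le_gchoose_mult) (auto simp: M_def)
    also have "\<dots> = (exp (8 * sqrt (4 * \<eta>) * (s1 + s2)) * (exp 1 * s1) * (exp 1 * s2))
        * pair_count_bound G ((1 + 2 * \<eta>) * m) s1 s2 m"
      by (simp add: pair_count_bound_def M_def)
    also have "\<dots> \<le> exp (32 * sqrt \<eta> * s2 + 2 + 2 * ln s2) * pair_count_bound G ((1 + 2 * \<eta>) * m) s1 s2 m"
    proof (rule mult_right_mono)
      have "8 * sqrt (4 * \<eta>) * (s1 + s2) = 16 * sqrt \<eta> * (real s1 + s2)" by (simp add: real_sqrt_mult)
      also have "\<dots> \<le> 16 * sqrt \<eta> * (2 * s2)" using s \<eta> by (intro mult_left_mono) auto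
      finally have 1: "exp (8 * sqrt (4 * \<eta>) * (s1 + s2)) \<le> exp (32 * sqrt \<eta> * s2)" by simp
      have "exp 1 * real s1 \<le> exp (1 + ln s2)" "exp 1 * real s2 \<le> exp (1 + ln s2)"
        using s by (auto simp: exp_add)
      then have "exp (8 * sqrt (4 * \<eta>) * (s1 + s2)) * (exp 1 * s1) * (exp 1 * s2)
        \<le> exp (32 * sqrt \<eta> * s2) * exp (1 + ln s2) * exp (1 + ln s2)"
        using 1 by (intro mult_mono) auto
      also have "\<dots> = exp (32 * sqrt \<eta> * s2 + 2 + 2 * ln s2)" by (simp flip: exp_add)
      finally show "exp (8 * sqrt (4 * \<eta>) * (s1 + s2)) * (exp 1 * s1) * (exp 1 * s2)
        \<le> exp (32 * sqrt \<eta> * s2 + 2 + 2 * ln s2)" .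
      show "0 \<le> pair_count_bound G ((1 + 2 * \<eta>) * m) s1 s2 m"
        using pair_count_bound_ge_1[OF s(3)] by (rule order_trans[rotated]) simp
    qed
    finally show "real (N choose (s1 + s2))
      \<le> exp (32 * sqrt \<eta> * s2 + 2 + 2 * ln s2) * pair_count_bound G ((1 + 2 * \<eta>) * m) s1 s2 m" .
  qed simp
  finally show ?thesis by (simp add: exp_add mult_ac)
qed

section \<open>From fixed errors to o-terms\<close>

text \<open>Take for \<open>k n\<close> the largest \<open>j \<le> n\<close> whose threshold is at
  most \<open>n\<close>. This turns statements for each fixed error into one statement with an error
  tending to 0.\<close>

lemma diagonal_eventually:
  fixes P :: "nat \<Rightarrow> nat \<Rightarrow> bool"
  assumes "\<And>j. \<forall>\<^sub>F n in sequentially. P j n"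
  shows "\<exists>k. filterlim k at_top sequentially \<and> (\<forall>\<^sub>F n in sequentially. P (k n) n)"
proof -
  obtain N where N: "\<And>j n. N j \<le> n \<Longrightarrow> P j n"
    using assms unfolding eventually_sequentially by metis
  define S where "S n = {j. j \<le> n \<and> N j \<le> n}" for n
  define k where "k n = Max (S n)" for n
  have fin: "finite (S n)" for n unfolding S_def by simp
  have "\<forall>\<^sub>F n in sequentially. j \<le> k n" for j
    using eventually_ge_at_top[of "max j (N j)"]
  proof eventually_elim
    case (elim n)
    then show ?case unfolding k_def using fin by (intro Max_ge) (auto simp: S_def)
  qed
  then have "filterlim k at_top sequentially" by (simp add: filterlim_at_top)
  moreover have "\<forall>\<^sub>F n in sequentially. P (k n) n"
    using eventually_ge_at_top[of "N 0"]
  proof eventually_elim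
    case (elim n)
    then have "S n \<noteq> {}" by (auto simp: S_def)
    then have "k n \<in> S n" unfolding k_def using fin by (intro Max_in)
    then show ?case using N by (simp add: S_def)
  qed
  ultimately show ?thesis by blast
qed

lemma ln_2_ge_half: "1 / 2 \<le> ln (2 :: real)"
proof -
  have "exp 1 \<le> (4 :: real)" using exp_le by linarith
  then have "1 \<le> ln (4 :: real)" by (simp add: ln_ge_iff)
  also have "ln (4 :: real) = 2 * ln 2" using ln_realpow[of 2 2] by simp
  finally show ?thesis by simp
qed

text \<open>For \<open>s2 n \<le> 1\<close> the comparison function is 0, since
  \<open>ln 0 = ln 1 = 0\<close> and division by 0 gives 0; hence \<open>m n = 0\<close> and all
  sizes vanish. For \<open>s2 n \<ge> 2\<close> the fourth power of \<open>ln (s2 n)\<close> is at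
  least \<open>1 / 16\<close>, which explains the constant \<open>c / 16\<close>.\<close>

lemma eventually_sumset_size:
  fixes s1 s2 m :: "nat \<Rightarrow> nat"
  assumes "\<And>n. s2 n \<le> n" "\<And>n. s1 n + s2 n \<le> m n"
    and small: "(\<lambda>n. real (m n)) \<in> o(\<lambda>n. real (s2 n) ^ 2 / (ln (real (s2 n)) ^ 4 * ln (real n) ^ 3))"
    and c: "0 < c"
  shows "\<forall>\<^sub>F n in sequentially. s1 n = 0 \<and> s2 n = 0 \<and> m n = 0 \<or>
    2 \<le> s2 n \<and> m n * ln n ^ 3 \<le> c * real (s2 n) ^ 2"
proof -
  have "0 < c / 16" using c by simp
  from landau_o.smallD[OF small this] show ?thesis
  proof eventually_elim
    case (elim n)
    show ?case
    proof (cases "2 \<le> s2 n")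
      case False
      then have "s2 n = 0 \<or> s2 n = 1" by linarith
      then have "m n = 0" using elim by auto
      then show ?thesis using assms(2)[of n] by auto
    next
      case True
      then have n: "2 \<le> n" using assms(1)[of n] by linarith
      have "1 / 2 \<le> ln (2 :: real)" by (rule ln_2_ge_half)
      also have "\<dots> \<le> ln (s2 n)" using True by simp
      finally have "(1 / 2) ^ 4 \<le> ln (s2 n) ^ 4" by (intro power_mono) auto
      then have l4: "1 / 16 \<le> ln (s2 n) ^ 4" by (simp add: power_divide)
      have l3: "0 < ln n ^ 3" using n by simp
      then have p: "0 < ln (s2 n) ^ 4 * ln n ^ 3" using l4 by (intro mult_pos_pos) auto
      have "real (m n) \<le> c / 16 * (real (s2 n) ^ 2 / (ln (s2 n) ^ 4 * ln n ^ 3))"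
        using elim p by simp
      then have "m n * (ln (s2 n) ^ 4 * ln n ^ 3) \<le> c / 16 * real (s2 n) ^ 2"
        using p by (simp add: field_simps)
      moreover have "m n * (1 / 16 * ln n ^ 3) \<le> m n * (ln (s2 n) ^ 4 * ln n ^ 3)"
        using l4 l3 by (intro mult_left_mono mult_right_mono) auto
      ultimately have "m n * ln n ^ 3 \<le> c * real (s2 n) ^ 2" by simp
      then show ?thesis using True by simp
    qed
  qed
qed

text \<open>The group and the sets are quantified inside the eventuality, so the threshold depends
  on \<kappa> and the three sequences only; the o-terms obtained later are therefore uniform in
  them.\<close>

lemma eventually_card_small_sumset_pairs_le:
  fixes s1 s2 m :: "nat \<Rightarrow> nat" and \<kappa> :: real
  assumes s: "\<And>n. s2 n \<le> n" "\<And>n. s1 n \<le> s2 n" "\<And>n. s1 n + s2 n \<le> m n"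
    and omega: "(\<lambda>n. real (s1 n)) \<in> \<Omega>(\<lambda>n. real (s2 n))"
    and small: "(\<lambda>n. real (m n)) \<in> o(\<lambda>n. real (s2 n) ^ 2 / (ln (real (s2 n)) ^ 4 * ln (real n) ^ 3))"
    and \<kappa>: "0 < \<kappa>" "\<kappa> \<le> 1"
  shows "\<forall>\<^sub>F n in sequentially. \<forall>G :: 'a monoid. \<forall>F1 F2. comm_group G \<longrightarrow>
      F1 \<subseteq> carrier G \<longrightarrow> F2 \<subseteq> carrier G \<longrightarrow> finite F1 \<longrightarrow> finite F2 \<longrightarrow> card F1 = n \<longrightarrow> card F2 = n \<longrightarrow>
      card (small_sumset_pairs G F1 F2 (s1 n) (s2 n) (m n))
        \<le> 2 powr (\<kappa> * s2 n) * pair_count_bound G ((1 + 2 * (\<kappa> / 128)\<^sup>2) * m n) (s1 n) (s2 n) (m n)"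
proof -
  obtain c0 where c0: "0 < c0" "\<forall>\<^sub>F n in sequentially. c0 * norm (real (s2 n)) \<le> norm (real (s1 n))"
    using omega by (rule landau_omega.bigE)
  \<comment> \<open>Then \<open>32 * sqrt \<eta> = \<kappa> / 4\<close>. With
    \<open>\<kappa> / 8\<close> for each of the other two losses the total is
    \<open>\<kappa> / 2\<close>, which is at most \<open>\<kappa> * ln 2\<close>.\<close>
  define \<eta> where "\<eta> = (\<kappa> / 128)\<^sup>2"
  define \<epsilon> where "\<epsilon> = \<eta> ^ 5 / 2048"
  have "\<kappa>\<^sup>2 \<le> 1" using \<kappa> by (simp add: power_le_one)
  then have \<eta>: "0 < \<eta>" "\<eta> \<le> 1 / 4" using \<kappa> by (auto simp: \<eta>_def power_divide)
  have sq: "sqrt \<eta> = \<kappa> / 128" using \<kappa> by (simp add: \<eta>_def)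
  have \<epsilon>: "0 < \<epsilon>" "\<epsilon> \<le> 1" using \<eta> power_le_one[of \<eta> 5] by (auto simp: \<epsilon>_def)
  \<comment> \<open>The square root of \<open>m * (ln n)^3\<close> will be at most
    \<open>r * s2\<close>. The first entry then makes it small against
    \<open>s1 \<ge> c0 * s2\<close>; the second, with \<open>11200 = 8 * 1400\<close>, makes the
    number of terminal states cost at most \<open>\<kappa> / 8 * s2\<close>.\<close>
  define r where "r = min (\<epsilon> * c0 / 4) (\<kappa> * \<epsilon>\<^sup>2 / 11200)"
  have r0: "0 < r" using \<epsilon> c0 \<kappa> by (simp add: r_def)
  have r1: "r \<le> \<epsilon> * c0 / 4" "r \<le> \<kappa> * \<epsilon>\<^sup>2 / 11200" by (auto simp: r_def)
  have "\<kappa> * \<epsilon>\<^sup>2 \<le> \<kappa> * 1" using \<epsilon> \<kappa> by (intro mult_left_mono) (auto simp: power_le_one)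
  then have r2: "r \<le> \<kappa> / 48" using r1 \<kappa> by linarith
  have "\<kappa> * \<epsilon>\<^sup>2 \<le> 1 * (\<epsilon> * 1)" unfolding power2_eq_square using \<epsilon> \<kappa> by (intro mult_mono) auto
  then have r3: "r \<le> \<epsilon> / 16" using r1 \<epsilon> by linarith
  have "r * r \<le> r * 1" using r0 r2 \<kappa> by (intro mult_left_mono) auto
  then have r4: "16 * r\<^sup>2 \<le> \<epsilon>" unfolding power2_eq_square using r3 by linarith
  have "0 < r\<^sup>2" using r0 by simp
  from eventually_sumset_size[OF s(1,3) small this] c0(2) eventually_ge_at_top[of 3]
  show ?thesis
  proof (eventually_elim, intro allI impI)
    fix n and G :: "'a monoid" and F1 F2
    assume dich: "s1 n = 0 \<and> s2 n = 0 \<and> m n = 0 \<or> 2 \<le> s2 n \<and> m n * ln n ^ 3 \<le> r\<^sup>2 * real (s2 n) ^ 2"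
      and omg: "c0 * norm (real (s2 n)) \<le> norm (real (s1 n))" and n: "3 \<le> n"
      and G: "comm_group G"
      and F: "F1 \<subseteq> carrier G" "F2 \<subseteq> carrier G" "finite F1" "finite F2" "card F1 = n" "card F2 = n"
    interpret comm_group G by fact
    show "card (small_sumset_pairs G F1 F2 (s1 n) (s2 n) (m n))
        \<le> 2 powr (\<kappa> * s2 n) * pair_count_bound G ((1 + 2 * (\<kappa> / 128)\<^sup>2) * m n) (s1 n) (s2 n) (m n)"
      using dich
    proof
      assume z: "s1 n = 0 \<and> s2 n = 0 \<and> m n = 0"
      have "X = {}" if "X \<subseteq> F" "card X = 0" "finite F" for X F :: "'a set"
        using finite_subset[OF that(1,3)] that(2) by simp
      then have "small_sumset_pairs G F1 F2 0 0 0 \<subseteq> {({}, {})}"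
        using F by (auto simp: small_sumset_pairs_def)
      then have "card (small_sumset_pairs G F1 F2 0 0 0) \<le> card {({} :: 'a set, {} :: 'a set)}"
        by (intro card_mono) auto
      then show ?thesis using z by (simp add: pair_count_bound_def)
    next
      assume big: "2 \<le> s2 n \<and> m n * ln n ^ 3 \<le> r\<^sup>2 * real (s2 n) ^ 2"
      have "exp 1 \<le> real n" using n exp_le by linarith
      then have l: "1 \<le> ln n" using n by (simp add: ln_ge_iff)
      then have l3: "1 \<le> ln n ^ 3" "ln n \<le> ln n ^ 3"
        using power_increasing[of 1 3 "ln (real n)"] by (auto simp: one_le_power)
      have s2: "0 < real (s2 n)" using big by simp
      have sm: "real (s2 n) \<le> m n" using s(3)[of n] by linarith
      have "real (s2 n) * ln n ^ 3 \<le> m n * ln n ^ 3" using sm l by (intro mult_right_mono) auto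
      moreover have "r\<^sup>2 * real (s2 n) ^ 2 = real (s2 n) * (r\<^sup>2 * s2 n)"
        by (simp only: power2_eq_square[of "real (s2 n)"] mult_ac)
      ultimately have "real (s2 n) * ln n ^ 3 \<le> real (s2 n) * (r\<^sup>2 * s2 n)" using big by linarith
      \<comment> \<open>As \<open>s2 \<le> m\<close>, the size condition itself forces
        \<open>s2\<close> to be large compared with the logarithm of \<open>n\<close>.\<close>
      then have ls: "ln n ^ 3 \<le> r\<^sup>2 * s2 n" using s2 by simp
      have "sqrt (m n * ln n ^ 3) \<le> sqrt ((r * s2 n)\<^sup>2)"
        using big by (intro real_sqrt_le_mono) (simp add: power_mult_distrib)
      then have root: "sqrt (m n * ln n ^ 3) \<le> r * s2 n" using r0 by simp
      have h1: "16 * ln n \<le> \<epsilon> * m n"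
      proof -
        have "16 * ln n \<le> 16 * r\<^sup>2 * s2 n" using ls l3 by simp
        also have "\<dots> \<le> \<epsilon> * m n" using r4 sm \<epsilon> by (intro mult_mono) auto
        finally show ?thesis .
      qed
      have h2: "4 * sqrt (m n * ln n ^ 3) \<le> \<epsilon> * s1 n"
      proof -
        have "4 * sqrt (m n * ln n ^ 3) \<le> 4 * r * s2 n" using root by simp
        also have "\<dots> \<le> \<epsilon> * c0 * s2 n" using r1 by (intro mult_right_mono) auto
        also have "\<dots> \<le> \<epsilon> * s1 n" using omg \<epsilon> by simp
        finally show ?thesis .
      qed
      have s1: "1 \<le> s1 n"
      proof -
        have "0 < c0 * real (s2 n)" using c0 s2 by simp
        then have "0 < real (s1 n)" using omg by simp
        then show ?thesis by simp
      qed
      have h3: "1400 / \<epsilon>\<^sup>2 * sqrt (m n * ln n ^ 3) \<le> \<kappa> / 8 * s2 n"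
      proof -
        have "1400 / \<epsilon>\<^sup>2 * sqrt (m n * ln n ^ 3) \<le> 1400 / \<epsilon>\<^sup>2 * (r * s2 n)"
          using root \<epsilon> by (intro mult_left_mono) auto
        also have "\<dots> \<le> 1400 / \<epsilon>\<^sup>2 * (\<kappa> * \<epsilon>\<^sup>2 / 11200 * s2 n)"
          using r1 \<epsilon> by (intro mult_left_mono mult_right_mono) auto
        also have "\<dots> = \<kappa> / 8 * s2 n" using \<epsilon> by simp
        finally show ?thesis .
      qed
      have h4: "2 + 2 * ln (s2 n) \<le> \<kappa> / 8 * s2 n"
      proof -
        \<comment> \<open>Since \<open>r\<^sup>2 * s2 \<ge> 1\<close>, the root \<open>q\<close> is
          at least \<open>1 / r\<close>, which beats the constants in
          \<open>2 + 4 * ln q \<le> 6 * q\<close>.\<close>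
        define q where "q = sqrt (s2 n)"
        have q2: "real (s2 n) = q * q" by (simp add: q_def)
        have "1 \<le> r\<^sup>2 * s2 n" using ls l3 by simp
        then have "1 \<le> (r * q)\<^sup>2" by (simp add: q2 power2_eq_square mult_ac)
        then have "1 \<le> r * q" using r0 by (intro power2_le_imp_le[of 1]) (auto simp: q_def)
        also have "\<dots> \<le> \<kappa> / 48 * q" using r2 by (intro mult_right_mono) (auto simp: q_def)
        finally have kq: "6 \<le> \<kappa> / 8 * q" by simp
        have q1: "1 \<le> q" using big by (simp add: q_def)
        have "2 + 2 * ln (s2 n) = 2 + 4 * ln q" using q1 by (simp add: q2 ln_mult)
        also have "\<dots> \<le> 6 * q" using ln_le_minus_one[of q] q1 by simp
        also have "\<dots> \<le> \<kappa> / 8 * q * q" using kq q1 by (intro mult_right_mono) auto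
        finally show ?thesis by (simp add: q2)
      qed
      have "\<kappa> * s2 n * (1 / 2) \<le> \<kappa> * s2 n * ln 2" using \<kappa> ln_2_ge_half by (intro mult_left_mono) auto
      then have e: "exp (1400 / \<epsilon>\<^sup>2 * sqrt (m n * ln n ^ 3) + 32 * sqrt \<eta> * s2 n + 2 + 2 * ln (s2 n))
        \<le> 2 powr (\<kappa> * s2 n)"
        using h3 h4 unfolding sq by (simp add: powr_def)
      have "card (small_sumset_pairs G F1 F2 (s1 n) (s2 n) (m n))
        \<le> exp (1400 / \<epsilon>\<^sup>2 * sqrt (m n * ln n ^ 3) + 32 * sqrt \<eta> * s2 n + 2 + 2 * ln (s2 n))
          * pair_count_bound G ((1 + 2 * \<eta>) * m n) (s1 n) (s2 n) (m n)"
        unfolding \<epsilon>_def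
        by (rule card_small_sumset_pairs_le_exp[OF \<eta> n s1 s(2,3)]) (use h1 h2 F in \<open>auto simp: \<epsilon>_def\<close>)
      also have "\<dots> \<le> 2 powr (\<kappa> * s2 n) * pair_count_bound G ((1 + 2 * \<eta>) * m n) (s1 n) (s2 n) (m n)"
        using pair_count_bound_ge_1[OF s(3), of G "(1 + 2 * \<eta>) * m n" n]
        by (intro mult_right_mono e) linarith
      finally show ?thesis by (simp add: \<eta>_def)
    qed
  qed
qed

theorem theorem1p2:
  fixes s1 s2 m :: "nat \<Rightarrow> nat"
  assumes "\<And>n. s2 n \<le> n"
    and "\<And>n. s1 n \<le> s2 n"
    and "(\<lambda>n. real (s1 n)) \<in> \<Omega>(\<lambda>n. real (s2 n))"
    and "\<And>n. s1 n + s2 n \<le> m n"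
    and "(\<lambda>n. real (m n)) \<in> o(\<lambda>n. real (s2 n) ^ 2 / (ln (real (s2 n)) ^ 4 * ln (real n) ^ 3))"
  shows "\<exists>\<eta> \<delta> :: nat \<Rightarrow> real.
           \<eta> \<in> o(\<lambda>n. real (s2 n)) \<and> \<delta> \<in> o(\<lambda>_. 1) \<and>
           (\<forall>n. \<forall>G :: 'a monoid. \<forall>F1 F2.
              comm_group G \<longrightarrow>
              F1 \<subseteq> carrier G \<longrightarrow> F2 \<subseteq> carrier G \<longrightarrow>
              finite F1 \<longrightarrow> finite F2 \<longrightarrow> card F1 = n \<longrightarrow> card F2 = n \<longrightarrow>
              (let \<beta> = real (subgroup_beta G ((1 + \<delta> n) * real (m n)));
                   a1 = real (s1 n) / (real (s1 n) + real (s2 n));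
                   a2 = real (s2 n) / (real (s1 n) + real (s2 n))
               in real (card (small_sumset_pairs G F1 F2 (s1 n) (s2 n) (m n)))
                    \<le> 2 powr (\<eta> n)
                        * ((a1 * (real (m n) + \<beta>)) gchoose (s1 n))
                        * ((a2 * (real (m n) + \<beta>)) gchoose (s2 n))))"
proof -
  define \<kappa> where "\<kappa> j = 1 / (real j + 1)" for j :: nat
  define P where "P j n \<longleftrightarrow> (\<forall>G :: 'a monoid. \<forall>F1 F2. comm_group G \<longrightarrow>
      F1 \<subseteq> carrier G \<longrightarrow> F2 \<subseteq> carrier G \<longrightarrow> finite F1 \<longrightarrow> finite F2 \<longrightarrow> card F1 = n \<longrightarrow> card F2 = n \<longrightarrow>
      card (small_sumset_pairs G F1 F2 (s1 n) (s2 n) (m n))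
        \<le> 2 powr (\<kappa> j * s2 n) * pair_count_bound G ((1 + 2 * (\<kappa> j / 128)\<^sup>2) * m n) (s1 n) (s2 n) (m n))" for j n
  have "\<forall>\<^sub>F n in sequentially. P j n" for j
    unfolding P_def
    by (rule eventually_card_small_sumset_pairs_le[OF assms(1,2,4,3,5)]) (auto simp: \<kappa>_def)
  then have "\<exists>k. filterlim k at_top sequentially \<and> (\<forall>\<^sub>F n in sequentially. P (k n) n)"
    by (rule diagonal_eventually[of P])
  then obtain k where k: "filterlim k at_top sequentially"
    and Pk: "\<forall>\<^sub>F n in sequentially. P (k n) n" by (elim exE conjE) (rule that)
  have "(\<lambda>j. inverse (real (Suc j))) = \<kappa>"
    by (auto simp: \<kappa>_def fun_eq_iff inverse_eq_divide add.commute)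
  then have \<kappa>0: "\<kappa> \<longlonglongrightarrow> 0" using LIMSEQ_inverse_real_of_nat by simp
  have \<kappa>k: "(\<lambda>n. \<kappa> (k n)) \<longlonglongrightarrow> 0" using filterlim_compose[OF \<kappa>0 k] .
  define \<eta> where "\<eta> n = (if P (k n) n then \<kappa> (k n) * s2 n else 2 * real n)" for n
  define \<delta> where "\<delta> n = 2 * (\<kappa> (k n) / 128)\<^sup>2" for n
  show ?thesis
  proof (rule exI[of _ \<eta>], rule exI[of _ \<delta>], intro conjI allI impI)
    show "\<eta> \<in> o(\<lambda>n. real (s2 n))"
    proof (rule landau_o.smallI)
      fix c :: real assume c: "0 < c"
      have "\<forall>\<^sub>F n in sequentially. norm (\<kappa> (k n)) < c" using \<kappa>k c by (auto simp: tendsto_iff dist_norm)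
      then show "\<forall>\<^sub>F n in sequentially. norm (\<eta> n) \<le> c * norm (real (s2 n))"
        using Pk by eventually_elim (auto simp: \<eta>_def abs_mult intro!: mult_right_mono)
    qed
    have "(\<lambda>n. 2 * (\<kappa> (k n) / 128)\<^sup>2) \<longlonglongrightarrow> 2 * (0 / 128)\<^sup>2" by (intro tendsto_intros \<kappa>k) simp
    then have "\<delta> \<longlonglongrightarrow> 0" by (simp add: \<delta>_def[abs_def])
    then show "\<delta> \<in> o(\<lambda>_. 1)" by (intro smalloI_tendsto) auto
    fix n and G :: "'a monoid" and F1 F2
    assume F: "comm_group G" "F1 \<subseteq> carrier G" "F2 \<subseteq> carrier G" "finite F1" "finite F2" "card F1 = n" "card F2 = n"
    have "card (small_sumset_pairs G F1 F2 (s1 n) (s2 n) (m n))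
      \<le> 2 powr (\<eta> n) * pair_count_bound G ((1 + \<delta> n) * m n) (s1 n) (s2 n) (m n)"
    proof (cases "P (k n) n")
      case True
      then show ?thesis using F unfolding P_def \<eta>_def \<delta>_def by simp
    next
      case False
      have "small_sumset_pairs G F1 F2 (s1 n) (s2 n) (m n) \<subseteq> Pow F1 \<times> Pow F2"
        by (auto simp: small_sumset_pairs_def)
      then have "card (small_sumset_pairs G F1 F2 (s1 n) (s2 n) (m n)) \<le> card (Pow F1 \<times> Pow F2)"
        using F by (intro card_mono) auto
      also have "\<dots> = 2 ^ (2 * n)" using F by (simp add: card_cartesian_product card_Pow power_add mult_2)
      finally have "real (card (small_sumset_pairs G F1 F2 (s1 n) (s2 n) (m n))) \<le> real (2 ^ (2 * n))"
        by (rule of_nat_mono)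
      also have "\<dots> = 2 powr (\<eta> n) * 1" using False powr_realpow[of 2 "2 * n"] by (simp add: \<eta>_def)
      also have "\<dots> \<le> 2 powr (\<eta> n) * pair_count_bound G ((1 + \<delta> n) * m n) (s1 n) (s2 n) (m n)"
        by (intro mult_left_mono pair_count_bound_ge_1 assms) simp
      finally show ?thesis .
    qed
    then show "let \<beta> = real (subgroup_beta G ((1 + \<delta> n) * real (m n)));
                   a1 = real (s1 n) / (real (s1 n) + real (s2 n));
                   a2 = real (s2 n) / (real (s1 n) + real (s2 n))
               in real (card (small_sumset_pairs G F1 F2 (s1 n) (s2 n) (m n)))
                    \<le> 2 powr (\<eta> n)
                        * ((a1 * (real (m n) + \<beta>)) gchoose (s1 n))
                        * ((a2 * (real (m n) + \<beta>)) gchoose (s2 n))"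
      by (simp add: Let_def pair_count_bound_def mult.assoc)
  qed
qed

end
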